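(* Let $\mathcal C', \mathcal C, \mathcal C''$ be triangulated categories. Then there is a one-one correspondence between $USR(\mathcal C',\mathcal C,\mathcal C'')$, the class of equivalence classes of upper-symmetric triangulated category recollements of $\mathcal C$ relative to $\mathcal C'$ and $\mathcal C''$, and $LSR(\mathcal C'',\mathcal C,\mathcal C')$, the class of equivalence classes of lower-symmetric triangulated category recollements of $\mathcal C$ relative to $\mathcal C''$ and $\mathcal C'$.
   Context: Triangulated category recollement: for triangulated categories $\mathcal C',\mathcal C,\mathcal C''$, a recollement of $\mathcal C$ relative to $\mathcal C'$ and $\mathcal C''$ is a six-tuple $(i^*,i_*,i^!;j_!,j^*,j_* )$ of exact (triangle) functors $i^*,i^!:\mathcal C\to\mathcal C'$, $i_*:\mathcal C'\to\mathcal C$, $j_!,j_*:\mathcal C''\to\mathcal C$, $j^*:\mathcal C\to\mathcal C''$ such that: (R1) $(i^*,i_* )$, $(i_*,i^!)$, $(j_!,j^* )$, $(j^*,j_* )$ are adjoint pairs (left adjoint written first); (R2) $i_*,j_!,j_*$ are fully faithful; (R3) $j^*i_*=0$; (R4) for each object $X\in\mathcal C$ the counits and units give rise to distinguished triangles $j_!j^*X\to X\to i_*i^*X\to$ and $i_*i^!X\to X\to j_*j^*X\to$. Upper-symmetric: the recollement $(i^*,i_*,i^!;j_!,j^*,j_* )$ of $\mathcal C$ relative to $\mathcal C'$ and $\mathcal C''$ is upper-symmetric if there are exact functors $j_?:\mathcal C\to\mathcal C''$ and $i_?:\mathcal C'\to\mathcal C$ such that $(j^*,j_*,j_?;\,i_*,i^!,i_?)$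 is a recollement of $\mathcal C$ relative to $\mathcal C''$ and $\mathcal C'$. Lower-symmetric: it is lower-symmetric if there are exact functors $j^?:\mathcal C\to\mathcal C''$ and $i^?:\mathcal C'\to\mathcal C$ such that $(j^?,j_!,j^*;\,i^?,i^*,i_* )$ is a recollement of $\mathcal C$ relative to $\mathcal C''$ and $\mathcal C'$. Equivalence: given recollements $(i^*,i_*,i^!;j_!,j^*,j_* )$ of $\mathcal C$ and $(i_D^*,i^D_*,i_D^!;j^D_!,j_D^*,j^D_* )$ of $\mathcal D$, both relative to $\mathcal C'$ and $\mathcal C''$, a comparison functor is an exact functor $f:\mathcal C\to\mathcal D$ with natural isomorphisms $i^*\approx i_D^*f$, $fi_*\approx i^D_*$, $i^!\approx i_D^!f$, $fj_!\approx j^D_!$, $j^*\approx j_D^*f$, $fj_*\approx j^D_*$. The two recollements are equivalent if there is a comparison functor which is an equivalence of categories. *)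

theory Defs
  imports "HOL-Algebra.Group"
begin

section \<open>Categories and functors\<close>

text \<open>A category consists of a set of objects and a set of arrows; every arrow has one domain and one
  codomain, so distinct hom-sets are disjoint. The record fields are only meaningful on
  \<open>Obj\<close>, \<open>Arr\<close> and composable pairs.\<close>

record ('o, 'm) cat =
  Obj :: "'o set"
  Arr :: "'m set"
  Dom :: "'m \<Rightarrow> 'o"
  Cod :: "'m \<Rightarrow> 'o"
  Ident :: "'o \<Rightarrow> 'm"
  Comp :: "'m \<Rightarrow> 'm \<Rightarrow> 'm"  (infixl \<open>\<cdot>\<index>\<close> 70)

definition Hom :: "('o, 'm, 'z) cat_scheme \<Rightarrow> 'o \<Rightarrow> 'o \<Rightarrow> 'm set" where
  "Hom C X Y = {f \<in> Arr C. Dom C f = X \<and> Cod C f = Y}"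

locale category =
  fixes C :: "('o, 'm, 'z) cat_scheme" (structure)
  assumes dom_closed: "f \<in> Arr C \<Longrightarrow> Dom C f \<in> Obj C"
    and cod_closed: "f \<in> Arr C \<Longrightarrow> Cod C f \<in> Obj C"
    and ident_closed: "X \<in> Obj C \<Longrightarrow> Ident C X \<in> Hom C X X"
    and comp_closed: "f \<in> Hom C X Y \<Longrightarrow> g \<in> Hom C Y Z \<Longrightarrow> g \<cdot> f \<in> Hom C X Z"
    and comp_ident_right: "f \<in> Hom C X Y \<Longrightarrow> f \<cdot> Ident C X = f"
    and comp_ident_left: "f \<in> Hom C X Y \<Longrightarrow> Ident C Y \<cdot> f = f"
    and comp_assoc: "f \<in> Hom C X Y \<Longrightarrow> g \<in> Hom C Y Z \<Longrightarrow> h \<in> Hom C Z W \<Longrightarrow>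
      (h \<cdot> g) \<cdot> f = h \<cdot> (g \<cdot> f)"

definition iso_arr :: "('o, 'm, 'z) cat_scheme \<Rightarrow> 'm \<Rightarrow> bool" where
  "iso_arr C f \<longleftrightarrow> f \<in> Arr C \<and>
    (\<exists>g \<in> Hom C (Cod C f) (Dom C f).
      g \<cdot>\<^bsub>C\<^esub> f = Ident C (Dom C f) \<and> f \<cdot>\<^bsub>C\<^esub> g = Ident C (Cod C f))"

definition zero_object :: "('o, 'm, 'z) cat_scheme \<Rightarrow> 'o \<Rightarrow> bool" where
  "zero_object C Z \<longleftrightarrow> Z \<in> Obj C \<and>
    (\<forall>X \<in> Obj C. (\<exists>!f. f \<in> Hom C Z X) \<and> (\<exists>!f. f \<in> Hom C X Z))"

record ('o, 'm, 'p, 'n) cfunctor =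
  FObj :: "'o \<Rightarrow> 'p"
  FArr :: "'m \<Rightarrow> 'n"

locale is_functor =
  source: category C + target: category D
  for C :: "('o, 'm, 'y) cat_scheme" and D :: "('p, 'n, 'z) cat_scheme" +
  fixes F :: "('o, 'm, 'p, 'n) cfunctor"
  assumes obj_closed: "X \<in> Obj C \<Longrightarrow> FObj F X \<in> Obj D"
    and arr_closed: "f \<in> Hom C X Y \<Longrightarrow> FArr F f \<in> Hom D (FObj F X) (FObj F Y)"
    and preserves_ident: "X \<in> Obj C \<Longrightarrow> FArr F (Ident C X) = Ident D (FObj F X)"
    and preserves_comp: "f \<in> Hom C X Y \<Longrightarrow> g \<in> Hom C Y Z \<Longrightarrow>
      FArr F (g \<cdot>\<^bsub>C\<^esub> f) = FArr F g \<cdot>\<^bsub>D\<^esub> FArr F f"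

definition id_functor :: "('o, 'm, 'o, 'm) cfunctor" where
  "id_functor = \<lparr>FObj = (\<lambda>X. X), FArr = (\<lambda>f. f)\<rparr>"

definition comp_functor ::
    "('p, 'n, 'q, 'k) cfunctor \<Rightarrow> ('o, 'm, 'p, 'n) cfunctor \<Rightarrow> ('o, 'm, 'q, 'k) cfunctor"
    (infixl \<open>\<circ>\<^sub>F\<close> 55) where
  "G \<circ>\<^sub>F F = \<lparr>FObj = FObj G \<circ> FObj F, FArr = FArr G \<circ> FArr F\<rparr>"

locale nat_trans =
  F: is_functor C D F + G: is_functor C D G
  for C :: "('o, 'm, 'y) cat_scheme" and D :: "('p, 'n, 'z) cat_scheme"
    and F G :: "('o, 'm, 'p, 'n) cfunctor" +
  fixes \<tau> :: "'o \<Rightarrow> 'n"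
  assumes component: "X \<in> Obj C \<Longrightarrow> \<tau> X \<in> Hom D (FObj F X) (FObj G X)"
    and naturality: "f \<in> Hom C X Y \<Longrightarrow> \<tau> Y \<cdot>\<^bsub>D\<^esub> FArr F f = FArr G f \<cdot>\<^bsub>D\<^esub> \<tau> X"

locale nat_iso = nat_trans +
  assumes component_iso: "X \<in> Obj C \<Longrightarrow> iso_arr D (\<tau> X)"

definition nat_isomorphic ::
    "('o, 'm, 'y) cat_scheme \<Rightarrow> ('p, 'n, 'z) cat_scheme \<Rightarrow>
     ('o, 'm, 'p, 'n) cfunctor \<Rightarrow> ('o, 'm, 'p, 'n) cfunctor \<Rightarrow> bool" where
  "nat_isomorphic C D F G \<longleftrightarrow> (\<exists>\<tau>. nat_iso C D F G \<tau>)"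

definition fully_faithful ::
    "('o, 'm, 'y) cat_scheme \<Rightarrow> ('p, 'n, 'z) cat_scheme \<Rightarrow> ('o, 'm, 'p, 'n) cfunctor \<Rightarrow> bool" where
  "fully_faithful C D F \<longleftrightarrow> is_functor C D F \<and>
    (\<forall>X \<in> Obj C. \<forall>Y \<in> Obj C.
      bij_betw (FArr F) (Hom C X Y) (Hom D (FObj F X) (FObj F Y)))"

definition equivalence_of_categories ::
    "('o, 'm, 'y) cat_scheme \<Rightarrow> ('p, 'n, 'z) cat_scheme \<Rightarrow> ('o, 'm, 'p, 'n) cfunctor \<Rightarrow> bool" where
  "equivalence_of_categories C D F \<longleftrightarrow> is_functor C D F \<and>
    (\<exists>G. is_functor D C G \<and>
      nat_isomorphic C C (G \<circ>\<^sub>F F) id_functor \<and> nat_isomorphic D D (F \<circ>\<^sub>F G) id_functor)"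

text \<open>\<open>L : C \<rightarrow> D\<close> is left adjoint to \<open>R : D \<rightarrow> C\<close> with unit \<open>\<eta>\<close> and counit \<open>\<epsilon>\<close>.\<close>

locale adjunction =
  L: is_functor C D L + R: is_functor D C R +
  unit: nat_trans C C id_functor "R \<circ>\<^sub>F L" \<eta> +
  counit: nat_trans D D "L \<circ>\<^sub>F R" id_functor \<epsilon>
  for C :: "('o, 'm, 'y) cat_scheme" and D :: "('p, 'n, 'z) cat_scheme"
    and L :: "('o, 'm, 'p, 'n) cfunctor" and R :: "('p, 'n, 'o, 'm) cfunctor"
    and \<eta> :: "'o \<Rightarrow> 'm" and \<epsilon> :: "'p \<Rightarrow> 'n" +
  assumes triangle_left: "X \<in> Obj C \<Longrightarrow>
      \<epsilon> (FObj L X) \<cdot>\<^bsub>D\<^esub> FArr L (\<eta> X) = Ident D (FObj L X)"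
    and triangle_right: "Y \<in> Obj D \<Longrightarrow>
      FArr R (\<epsilon> Y) \<cdot>\<^bsub>C\<^esub> \<eta> (FObj R Y) = Ident C (FObj R Y)"

section \<open>Additive and triangulated categories\<close>

record ('o, 'm) additive_cat = "('o, 'm) cat" +
  Plus :: "'m \<Rightarrow> 'm \<Rightarrow> 'm"  (infixl \<open>\<oplus>\<^sub>h\<index>\<close> 65)
  Zero :: "'o \<Rightarrow> 'o \<Rightarrow> 'm"

definition hom_group :: "('o, 'm, 'z) additive_cat_scheme \<Rightarrow> 'o \<Rightarrow> 'o \<Rightarrow> 'm monoid" where
  "hom_group C X Y = \<lparr>carrier = Hom C X Y, monoid.mult = Plus C, one = Zero C X Y\<rparr>"

definition neg_arr :: "('o, 'm, 'z) additive_cat_scheme \<Rightarrow> 'm \<Rightarrow> 'm" where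
  "neg_arr C f = inv\<^bsub>hom_group C (Dom C f) (Cod C f)\<^esub> f"

locale additive_category = category C
  for C :: "('o, 'm, 'z) additive_cat_scheme" (structure) +
  assumes hom_comm_group: "X \<in> Obj C \<Longrightarrow> Y \<in> Obj C \<Longrightarrow> comm_group (hom_group C X Y)"
    and comp_plus_right: "f \<in> Hom C X Y \<Longrightarrow> f' \<in> Hom C X Y \<Longrightarrow> g \<in> Hom C Y Z \<Longrightarrow>
      g \<cdot> (f \<oplus>\<^sub>h f') = (g \<cdot> f) \<oplus>\<^sub>h (g \<cdot> f')"
    and comp_plus_left: "f \<in> Hom C X Y \<Longrightarrow> g \<in> Hom C Y Z \<Longrightarrow> g' \<in> Hom C Y Z \<Longrightarrow>
      (g \<oplus>\<^sub>h g') \<cdot> f = (g \<cdot> f) \<oplus>\<^sub>h (g' \<cdot> f)"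
    and has_zero_object: "\<exists>Z. zero_object C Z"
    and has_biproducts: "X \<in> Obj C \<Longrightarrow> Y \<in> Obj C \<Longrightarrow>
      \<exists>P \<in> Obj C. \<exists>p \<in> Hom C P X. \<exists>q \<in> Hom C P Y. \<exists>i \<in> Hom C X P. \<exists>j \<in> Hom C Y P.
        p \<cdot> i = Ident C X \<and> q \<cdot> j = Ident C Y \<and>
        q \<cdot> i = Zero C X Y \<and> p \<cdot> j = Zero C Y X \<and>
        (i \<cdot> p) \<oplus>\<^sub>h (j \<cdot> q) = Ident C P"

locale additive_functor =
  is_functor C D F + source: additive_category C + target: additive_category D
  for C :: "('o, 'm, 'y) additive_cat_scheme" and D :: "('p, 'n, 'z) additive_cat_scheme"
    and F :: "('o, 'm, 'p, 'n) cfunctor" +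
  assumes preserves_plus: "f \<in> Hom C X Y \<Longrightarrow> g \<in> Hom C X Y \<Longrightarrow>
      FArr F (f \<oplus>\<^sub>h\<^bsub>C\<^esub> g) = FArr F f \<oplus>\<^sub>h\<^bsub>D\<^esub> FArr F g"

text \<open>\<open>(u, v, w) \<in> Dist C\<close> stands for a distinguished triangle
  \<open>X \<rightarrow> Y \<rightarrow> Z \<rightarrow> T X\<close>; the objects are recovered as the domains of the arrows.\<close>

record ('o, 'm) tri_cat = "('o, 'm) additive_cat" +
  Shift :: "('o, 'm, 'o, 'm) cfunctor"
  Dist :: "('m \<times> 'm \<times> 'm) set"

abbreviation TO :: "('o, 'm, 'z) tri_cat_scheme \<Rightarrow> 'o \<Rightarrow> 'o" where
  "TO C \<equiv> FObj (Shift C)"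

abbreviation TA :: "('o, 'm, 'z) tri_cat_scheme \<Rightarrow> 'm \<Rightarrow> 'm" where
  "TA C \<equiv> FArr (Shift C)"

definition triangle ::
    "('o, 'm, 'z) tri_cat_scheme \<Rightarrow> 'o \<Rightarrow> 'o \<Rightarrow> 'o \<Rightarrow> 'm \<times> 'm \<times> 'm \<Rightarrow> bool" where
  "triangle C X Y Z = (\<lambda>(u, v, w). u \<in> Hom C X Y \<and> v \<in> Hom C Y Z \<and> w \<in> Hom C Z (TO C X))"

definition dist_triangle ::
    "('o, 'm, 'z) tri_cat_scheme \<Rightarrow> 'o \<Rightarrow> 'o \<Rightarrow> 'o \<Rightarrow> 'm \<times> 'm \<times> 'm \<Rightarrow> bool" where
  "dist_triangle C X Y Z t \<longleftrightarrow> triangle C X Y Z t \<and> t \<in> Dist C"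

definition triangle_morphism ::
    "('o, 'm, 'z) tri_cat_scheme \<Rightarrow> 'm \<times> 'm \<times> 'm \<Rightarrow> 'm \<times> 'm \<times> 'm \<Rightarrow> 'm \<Rightarrow> 'm \<Rightarrow> 'm \<Rightarrow> bool" where
  "triangle_morphism C = (\<lambda>(u, v, w) (u', v', w') f g h.
     f \<in> Hom C (Dom C u) (Dom C u') \<and> g \<in> Hom C (Dom C v) (Dom C v') \<and>
     h \<in> Hom C (Dom C w) (Dom C w') \<and>
     g \<cdot>\<^bsub>C\<^esub> u = u' \<cdot>\<^bsub>C\<^esub> f \<and> h \<cdot>\<^bsub>C\<^esub> v = v' \<cdot>\<^bsub>C\<^esub> g \<and> TA C f \<cdot>\<^bsub>C\<^esub> w = w' \<cdot>\<^bsub>C\<^esub> h)"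

text \<open>Verdier's axioms, with the shift an automorphism of the category.\<close>

locale triangulated_category =
  additive_category C + shift: additive_functor C C "Shift C"
  for C :: "('o, 'm, 'z) tri_cat_scheme" (structure) +
  assumes shift_bij_obj: "bij_betw (TO C) (Obj C) (Obj C)"
    and shift_bij_arr: "bij_betw (TA C) (Arr C) (Arr C)"
    and dist_is_triangle: "t \<in> Dist C \<Longrightarrow>
      \<exists>X \<in> Obj C. \<exists>Y \<in> Obj C. \<exists>Z \<in> Obj C. triangle C X Y Z t"
    and TR1_iso: "dist_triangle C X Y Z t \<Longrightarrow> triangle C X' Y' Z' t' \<Longrightarrow>
      triangle_morphism C t t' f g h \<Longrightarrow> iso_arr C f \<Longrightarrow> iso_arr C g \<Longrightarrow> iso_arr C h \<Longrightarrow> t' \<in> Dist C"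
    and TR1_ident: "X \<in> Obj C \<Longrightarrow> zero_object C Z \<Longrightarrow>
      (Ident C X, Zero C X Z, Zero C Z (TO C X)) \<in> Dist C"
    and TR1_cone: "u \<in> Hom C X Y \<Longrightarrow> \<exists>Z v w. dist_triangle C X Y Z (u, v, w)"
    and TR2: "triangle C X Y Z (u, v, w) \<Longrightarrow>
      (u, v, w) \<in> Dist C \<longleftrightarrow> (v, w, neg_arr C (TA C u)) \<in> Dist C"
    and TR3: "dist_triangle C X Y Z (u, v, w) \<Longrightarrow> dist_triangle C X' Y' Z' (u', v', w') \<Longrightarrow>
      f \<in> Hom C X X' \<Longrightarrow> g \<in> Hom C Y Y' \<Longrightarrow> g \<cdot> u = u' \<cdot> f \<Longrightarrow>
      \<exists>h. triangle_morphism C (u, v, w) (u', v', w') f g h"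
    and TR4: "dist_triangle C X Y Z' (u, i, i') \<Longrightarrow> dist_triangle C Y Z X' (v, j, j') \<Longrightarrow>
      dist_triangle C X Z Y' (v \<cdot> u, k, k') \<Longrightarrow>
      \<exists>f g. dist_triangle C Z' Y' X' (f, g, TA C i \<cdot> j') \<and>
        triangle_morphism C (u, i, i') (v \<cdot> u, k, k') (Ident C X) v f \<and>
        triangle_morphism C (v \<cdot> u, k, k') (v, j, j') u (Ident C Z) g"

definition exact_functor ::
    "('o, 'm, 'y) tri_cat_scheme \<Rightarrow> ('p, 'n, 'z) tri_cat_scheme \<Rightarrow>
     ('o, 'm, 'p, 'n) cfunctor \<Rightarrow> bool" where
  "exact_functor C D F \<longleftrightarrow> additive_functor C D F \<and>
    (\<exists>\<phi>. nat_iso C D (F \<circ>\<^sub>F Shift C) (Shift D \<circ>\<^sub>F F) \<phi> \<and>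
      (\<forall>X Y Z u v w. dist_triangle C X Y Z (u, v, w) \<longrightarrow>
        (FArr F u, FArr F v, \<phi> X \<cdot>\<^bsub>D\<^esub> FArr F w) \<in> Dist D))"

section \<open>Recollements\<close>

text \<open>The fields are \<open>(i\<^sup>*, i\<^sub>*, i\<^sup>!; j\<^sub>!, j\<^sup>*, j\<^sub>*)\<close>, where the primed
  category \<open>C'\<close> has type parameters \<open>('a, 'b)\<close>, the middle category \<open>C\<close> has \<open>('o, 'm)\<close> and
  \<open>C''\<close> has \<open>('c, 'd)\<close>.\<close>

record ('a, 'b, 'o, 'm, 'c, 'd) recollement_data =
  i_upper_star :: "('o, 'm, 'a, 'b) cfunctor"
  i_lower_star :: "('a, 'b, 'o, 'm) cfunctor"
  i_upper_shriek :: "('o, 'm, 'a, 'b) cfunctor"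
  j_lower_shriek :: "('c, 'd, 'o, 'm) cfunctor"
  j_upper_star :: "('o, 'm, 'c, 'd) cfunctor"
  j_lower_star :: "('c, 'd, 'o, 'm) cfunctor"

text \<open>Unit and counit of an adjunction are unique up to a natural automorphism, so the condition on
  the triangles does not depend on the chosen adjunctions.\<close>

definition recollement ::
    "('a, 'b) tri_cat \<Rightarrow> ('o, 'm) tri_cat \<Rightarrow> ('c, 'd) tri_cat \<Rightarrow>
     ('a, 'b, 'o, 'm, 'c, 'd) recollement_data \<Rightarrow> bool" where
  "recollement C' C C'' R \<longleftrightarrow>
    exact_functor C C' (i_upper_star R) \<and>
    exact_functor C' C (i_lower_star R) \<and>
    exact_functor C C' (i_upper_shriek R) \<and>
    exact_functor C'' C (j_lower_shriek R) \<and>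
    exact_functor C C'' (j_upper_star R) \<and>
    exact_functor C'' C (j_lower_star R) \<and>
    fully_faithful C' C (i_lower_star R) \<and>
    fully_faithful C'' C (j_lower_shriek R) \<and>
    fully_faithful C'' C (j_lower_star R) \<and>
    (\<forall>X \<in> Obj C'. zero_object C'' (FObj (j_upper_star R) (FObj (i_lower_star R) X))) \<and>
    (\<exists>\<eta>\<^sub>1 \<epsilon>\<^sub>1 \<eta>\<^sub>2 \<epsilon>\<^sub>2 \<eta>\<^sub>3 \<epsilon>\<^sub>3 \<eta>\<^sub>4 \<epsilon>\<^sub>4.
      adjunction C C' (i_upper_star R) (i_lower_star R) \<eta>\<^sub>1 \<epsilon>\<^sub>1 \<and>
      adjunction C' C (i_lower_star R) (i_upper_shriek R) \<eta>\<^sub>2 \<epsilon>\<^sub>2 \<and>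
      adjunction C'' C (j_lower_shriek R) (j_upper_star R) \<eta>\<^sub>3 \<epsilon>\<^sub>3 \<and>
      adjunction C C'' (j_upper_star R) (j_lower_star R) \<eta>\<^sub>4 \<epsilon>\<^sub>4 \<and>
      (\<forall>X \<in> Obj C. (\<exists>w. (\<epsilon>\<^sub>3 X, \<eta>\<^sub>1 X, w) \<in> Dist C) \<and> (\<exists>w. (\<epsilon>\<^sub>2 X, \<eta>\<^sub>4 X, w) \<in> Dist C)))"

definition upper_symmetric ::
    "('a, 'b) tri_cat \<Rightarrow> ('o, 'm) tri_cat \<Rightarrow> ('c, 'd) tri_cat \<Rightarrow>
     ('a, 'b, 'o, 'm, 'c, 'd) recollement_data \<Rightarrow> bool" where
  "upper_symmetric C' C C'' R \<longleftrightarrow> recollement C' C C'' R \<and>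
    (\<exists>j_quest i_quest. exact_functor C C'' j_quest \<and> exact_functor C' C i_quest \<and>
      recollement C'' C C'
        \<lparr>i_upper_star = j_upper_star R, i_lower_star = j_lower_star R, i_upper_shriek = j_quest,
         j_lower_shriek = i_lower_star R, j_upper_star = i_upper_shriek R, j_lower_star = i_quest\<rparr>)"

definition lower_symmetric ::
    "('a, 'b) tri_cat \<Rightarrow> ('o, 'm) tri_cat \<Rightarrow> ('c, 'd) tri_cat \<Rightarrow>
     ('a, 'b, 'o, 'm, 'c, 'd) recollement_data \<Rightarrow> bool" where
  "lower_symmetric C' C C'' R \<longleftrightarrow> recollement C' C C'' R \<and>
    (\<exists>j_quest i_quest. exact_functor C C'' j_quest \<and> exact_functor C' C i_quest \<and>
      recollement C'' C C'
        \<lparr>i_upper_star = j_quest, i_lower_star = j_lower_shriek R, i_upper_shriek = j_upper_star R,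
         j_lower_shriek = i_quest, j_upper_star = i_upper_star R, j_lower_star = i_lower_star R\<rparr>)"

definition comparison_functor ::
    "('a, 'b) tri_cat \<Rightarrow> ('c, 'd) tri_cat \<Rightarrow>
     ('o, 'm) tri_cat \<Rightarrow> ('a, 'b, 'o, 'm, 'c, 'd) recollement_data \<Rightarrow>
     ('p, 'n) tri_cat \<Rightarrow> ('a, 'b, 'p, 'n, 'c, 'd) recollement_data \<Rightarrow>
     ('o, 'm, 'p, 'n) cfunctor \<Rightarrow> bool" where
  "comparison_functor C' C'' C R D S f \<longleftrightarrow> exact_functor C D f \<and>
    nat_isomorphic C C' (i_upper_star R) (i_upper_star S \<circ>\<^sub>F f) \<and>
    nat_isomorphic C' D (f \<circ>\<^sub>F i_lower_star R) (i_lower_star S) \<and>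
    nat_isomorphic C C' (i_upper_shriek R) (i_upper_shriek S \<circ>\<^sub>F f) \<and>
    nat_isomorphic C'' D (f \<circ>\<^sub>F j_lower_shriek R) (j_lower_shriek S) \<and>
    nat_isomorphic C C'' (j_upper_star R) (j_upper_star S \<circ>\<^sub>F f) \<and>
    nat_isomorphic C'' D (f \<circ>\<^sub>F j_lower_star R) (j_lower_star S)"

definition equivalent_recollements ::
    "('a, 'b) tri_cat \<Rightarrow> ('c, 'd) tri_cat \<Rightarrow>
     ('o, 'm) tri_cat \<Rightarrow> ('a, 'b, 'o, 'm, 'c, 'd) recollement_data \<Rightarrow>
     ('p, 'n) tri_cat \<Rightarrow> ('a, 'b, 'p, 'n, 'c, 'd) recollement_data \<Rightarrow> bool" where
  "equivalent_recollements C' C'' C R D S \<longleftrightarrow>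
    (\<exists>f. comparison_functor C' C'' C R D S f \<and> equivalence_of_categories C D f)"

text \<open>Functors agreeing on objects and arrows of their source are naturally isomorphic, so the
  unspecified values of \<open>FObj\<close> and \<open>FArr\<close> elsewhere do not affect the equivalence classes.\<close>

definition USR ::
    "('a, 'b) tri_cat \<Rightarrow> ('o, 'm) tri_cat \<Rightarrow> ('c, 'd) tri_cat \<Rightarrow>
     ('a, 'b, 'o, 'm, 'c, 'd) recollement_data set set" where
  "USR C' C C'' = {R. upper_symmetric C' C C'' R} //
    {(R, S). upper_symmetric C' C C'' R \<and> upper_symmetric C' C C'' S \<and>
      equivalent_recollements C' C'' C R C S}"

definition LSR ::
    "('a, 'b) tri_cat \<Rightarrow> ('o, 'm) tri_cat \<Rightarrow> ('c, 'd) tri_cat \<Rightarrow>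
     ('a, 'b, 'o, 'm, 'c, 'd) recollement_data set set" where
  "LSR C' C C'' = {R. lower_symmetric C' C C'' R} //
    {(R, S). lower_symmetric C' C C'' R \<and> lower_symmetric C' C C'' S \<and>
      equivalent_recollements C' C'' C R C S}"

end

theory Submission
  imports Defs
begin

text \<open>A recollement of \<open>C\<close> relative to \<open>C'\<close> and \<open>C''\<close> is displayed as three rows of functors, each
  row left adjoint to the next. An upper-symmetric recollement extends by a fourth row, and
  forgetting the first of the four rows leaves a recollement \<open>S\<close> of \<open>C\<close> relative to \<open>C''\<close> and
  \<open>C'\<close>. This \<open>S\<close> is lower-symmetric, because the forgotten row is the extension that it needs.
  So upper-symmetric recollements \<open>R\<close> and lower-symmetric recollements \<open>S\<close> are the two ends of
  four-row ladders, and the correspondence relates the two ends of each ladder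
  (\<open>upper_neighbour\<close>).

  The ends of a ladder share the two middle rows, and every other row consists of adjoints of
  functors in those two. Adjoints are unique up to isomorphism, even along an equivalence of the
  middle categories: an equivalence that commutes with one functor of an adjoint pair commutes with
  the other (\<open>right_adjoint_source_equivalence\<close>, \<open>right_adjoint_target_equivalence\<close> and
  their duals). Hence an equivalence of middle categories is a comparison functor for the upper
  ends of two ladders iff it is one for the lower ends
  (\<open>equivalent_recollements_upper_neighbour_iff\<close>). Taking \<open>C\<close> itself and the identity, this
  also shows that the unspecified fourth row is determined up to equivalence. A correspondence that
  is total on both sides and transports one relation into the other induces a bijection of the
  classes (\<open>quotient_bij_betw_if_correspondence\<close>), as soon as both relations are
  preorders.\<close>

section \<open>Categories and natural isomorphisms\<close>

lemma (in category) Hom_obj: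
  assumes "f \<in> Hom C X Y"
  shows "X \<in> Obj C" "Y \<in> Obj C"
  using assms dom_closed cod_closed unfolding Hom_def by auto

lemma iso_arrI:
  assumes "f \<in> Hom C X Y" "g \<in> Hom C Y X"
    and "g \<cdot>\<^bsub>C\<^esub> f = Ident C X" "f \<cdot>\<^bsub>C\<^esub> g = Ident C Y"
  shows "iso_arr C f"
  using assms unfolding iso_arr_def Hom_def by auto

lemma iso_arrE:
  assumes "iso_arr C f" "f \<in> Hom C X Y"
  obtains g where "g \<in> Hom C Y X"
    and "g \<cdot>\<^bsub>C\<^esub> f = Ident C X" "f \<cdot>\<^bsub>C\<^esub> g = Ident C Y"
  using assms unfolding iso_arr_def Hom_def by auto

lemma (in category) iso_arr_comp:
  assumes "f \<in> Hom C X Y" "g \<in> Hom C Y Z" "iso_arr C f" "iso_arr C g"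
  shows "iso_arr C (g \<cdot> f)"
proof -
  obtain f' where f': "f' \<in> Hom C Y X" "f' \<cdot> f = Ident C X" "f \<cdot> f' = Ident C Y"
    using iso_arrE[OF assms(3,1)] by blast
  obtain g' where g': "g' \<in> Hom C Z Y" "g' \<cdot> g = Ident C Y" "g \<cdot> g' = Ident C Z"
    using iso_arrE[OF assms(4,2)] by blast
  show ?thesis
  proof (rule iso_arrI)
    show "g \<cdot> f \<in> Hom C X Z" and "f' \<cdot> g' \<in> Hom C Z X"
      using assms f'(1) g'(1) comp_closed by blast+
    have "(f' \<cdot> g') \<cdot> (g \<cdot> f) = f' \<cdot> ((g' \<cdot> g) \<cdot> f)"
      using comp_assoc[OF comp_closed[OF assms(1,2)] g'(1) f'(1)] comp_assoc[OF assms(1,2) g'(1)]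
      by simp
    then show "(f' \<cdot> g') \<cdot> (g \<cdot> f) = Ident C X"
      using f' g' comp_ident_left[OF assms(1)] by simp
    have "(g \<cdot> f) \<cdot> (f' \<cdot> g') = g \<cdot> ((f \<cdot> f') \<cdot> g')"
      using comp_assoc[OF comp_closed[OF g'(1) f'(1)] assms(1,2)] comp_assoc[OF g'(1) f'(1) assms(1)]
      by simp
    then show "(g \<cdot> f) \<cdot> (f' \<cdot> g') = Ident C Z"
      using f' g' comp_ident_left[OF g'(1)] by simp
  qed
qed

lemma (in category) postcompose_iso_bij:
  assumes "s \<in> Hom C Y Z" "iso_arr C s"
  shows "bij_betw (\<lambda>h. s \<cdot> h) (Hom C X Y) (Hom C X Z)"
proof -
  obtain t where t: "t \<in> Hom C Z Y" "t \<cdot> s = Ident C Y" "s \<cdot> t = Ident C Z"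
    using iso_arrE[OF assms(2,1)] by blast
  show ?thesis
  proof (rule bij_betw_byWitness[where f' = "\<lambda>h. t \<cdot> h"])
    show "\<forall>h\<in>Hom C X Y. t \<cdot> (s \<cdot> h) = h"
      using comp_assoc[OF _ assms(1) t(1)] comp_ident_left t(2) by metis
    show "\<forall>h\<in>Hom C X Z. s \<cdot> (t \<cdot> h) = h"
      using comp_assoc[OF _ t(1) assms(1)] comp_ident_left t(3) by metis
  qed (use comp_closed assms(1) t(1) in auto)
qed

lemma FObj_comp [simp]: "FObj (G \<circ>\<^sub>F F) X = FObj G (FObj F X)"
  and FArr_comp [simp]: "FArr (G \<circ>\<^sub>F F) f = FArr G (FArr F f)"
  and FObj_id [simp]: "FObj id_functor X = X"
  and FArr_id [simp]: "FArr id_functor f = f"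
  by (simp_all add: comp_functor_def id_functor_def)

lemma comp_functor_assoc: "(H \<circ>\<^sub>F G) \<circ>\<^sub>F F = H \<circ>\<^sub>F (G \<circ>\<^sub>F F)"
  by (simp add: comp_functor_def comp_assoc)

lemma comp_id_functor [simp]: "id_functor \<circ>\<^sub>F F = F" "F \<circ>\<^sub>F id_functor = F"
  by (simp_all add: comp_functor_def id_functor_def comp_def)

lemma is_functor_id: "category C \<Longrightarrow> is_functor C C id_functor"
  by (simp add: is_functor_def is_functor_axioms_def)

lemma is_functor_comp:
  assumes "is_functor C D F" "is_functor D E G"
  shows "is_functor C E (G \<circ>\<^sub>F F)"
proof -
  interpret F: is_functor C D F by fact
  interpret G: is_functor D E G by fact
  show ?thesis
    by unfold_locales
      (auto simp: F.obj_closed G.obj_closed F.preserves_ident G.preserves_ident F.preserves_comp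
        intro: F.arr_closed G.arr_closed G.preserves_comp[OF F.arr_closed F.arr_closed])
qed

lemma (in is_functor) preserves_iso:
  assumes "f \<in> Hom C X Y" "iso_arr C f"
  shows "iso_arr D (FArr F f)"
proof -
  obtain g where g: "g \<in> Hom C Y X" "g \<cdot>\<^bsub>C\<^esub> f = Ident C X" "f \<cdot>\<^bsub>C\<^esub> g = Ident C Y"
    using iso_arrE[OF assms(2,1)] by blast
  show ?thesis
    by (rule iso_arrI[OF arr_closed[OF assms(1)] arr_closed[OF g(1)]])
      (use preserves_comp[OF assms(1) g(1)] preserves_comp[OF g(1) assms(1)] g(2,3)
        preserves_ident source.Hom_obj[OF assms(1)] in auto)
qed

lemma nat_isomorphicI:
  assumes "is_functor C D F" "is_functor C D G"
    and "\<And>X. X \<in> Obj C \<Longrightarrow> \<tau> X \<in> Hom D (FObj F X) (FObj G X)"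
    and "\<And>X. X \<in> Obj C \<Longrightarrow> iso_arr D (\<tau> X)"
    and "\<And>X Y f. f \<in> Hom C X Y \<Longrightarrow> \<tau> Y \<cdot>\<^bsub>D\<^esub> FArr F f = FArr G f \<cdot>\<^bsub>D\<^esub> \<tau> X"
  shows "nat_isomorphic C D F G"
  unfolding nat_isomorphic_def
  using assms
  by (blast intro!: nat_iso.intro nat_trans.intro nat_trans_axioms.intro nat_iso_axioms.intro)

lemma nat_isomorphicE:
  assumes "nat_isomorphic C D F G"
  obtains \<tau> where "nat_iso C D F G \<tau>"
  using assms unfolding nat_isomorphic_def by blast

lemma iso_arr_Ident:
  assumes "category C" "X \<in> Obj C"
  shows "iso_arr C (Ident C X)"
  using category.ident_closed[OF assms] category.comp_ident_left[OF assms(1)]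
  by (intro iso_arrI[of _ _ X X "Ident C X"]) auto

lemma nat_iso_refl:
  assumes "is_functor C D F"
  shows "nat_iso C D F F (\<lambda>X. Ident D (FObj F X))"
proof -
  interpret F: is_functor C D F by fact
  show ?thesis
    by unfold_locales
      (auto simp: F.obj_closed F.target.comp_ident_left[OF F.arr_closed]
        F.target.comp_ident_right[OF F.arr_closed]
        intro: F.target.ident_closed iso_arr_Ident F.target.category_axioms)
qed

lemma nat_isomorphic_refl: "is_functor C D F \<Longrightarrow> nat_isomorphic C D F F"
  using nat_iso_refl unfolding nat_isomorphic_def by blast

text \<open>The chosen inverses of the components are automatically natural: conjugate the naturality
  square of \<open>\<tau>\<close> by them.\<close>

lemma nat_isomorphic_sym:
  assumes "nat_isomorphic C D F G"
  shows "nat_isomorphic C D G F"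
proof -
  obtain \<tau> where "nat_iso C D F G \<tau>" using assms by (rule nat_isomorphicE)
  then interpret nat_iso C D F G \<tau> .
  have "\<exists>s. \<forall>X\<in>Obj C. s X \<in> Hom D (FObj G X) (FObj F X) \<and>
      s X \<cdot>\<^bsub>D\<^esub> \<tau> X = Ident D (FObj F X) \<and> \<tau> X \<cdot>\<^bsub>D\<^esub> s X = Ident D (FObj G X)"
    by (intro bchoice ballI) (meson component component_iso iso_arrE)
  then obtain s where s: "\<And>X. X \<in> Obj C \<Longrightarrow> s X \<in> Hom D (FObj G X) (FObj F X)"
      "\<And>X. X \<in> Obj C \<Longrightarrow> s X \<cdot>\<^bsub>D\<^esub> \<tau> X = Ident D (FObj F X)"
      "\<And>X. X \<in> Obj C \<Longrightarrow> \<tau> X \<cdot>\<^bsub>D\<^esub> s X = Ident D (FObj G X)"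
    by blast
  show ?thesis
  proof (rule nat_isomorphicI)
    show "is_functor C D G" "is_functor C D F" by unfold_locales
    show "s X \<in> Hom D (FObj G X) (FObj F X)" if "X \<in> Obj C" for X using s(1) that .
    show "iso_arr D (s X)" if "X \<in> Obj C" for X
      using iso_arrI[OF s(1) component s(3) s(2)] that by blast
    fix X Y f assume f: "f \<in> Hom C X Y"
    note XY = F.source.Hom_obj[OF f]
    note Ff = F.arr_closed[OF f] and Gf = G.arr_closed[OF f]
    note a = F.target.comp_assoc
    have "s Y \<cdot>\<^bsub>D\<^esub> FArr G f = s Y \<cdot>\<^bsub>D\<^esub> (FArr G f \<cdot>\<^bsub>D\<^esub> (\<tau> X \<cdot>\<^bsub>D\<^esub> s X))"
      using s(3)[OF XY(1)] F.target.comp_ident_right[OF Gf] by simp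
    also have "\<dots> = s Y \<cdot>\<^bsub>D\<^esub> ((\<tau> Y \<cdot>\<^bsub>D\<^esub> FArr F f) \<cdot>\<^bsub>D\<^esub> s X)"
      using a[OF s(1)[OF XY(1)] component[OF XY(1)] Gf] naturality[OF f] by simp
    also have "\<dots> = (s Y \<cdot>\<^bsub>D\<^esub> \<tau> Y) \<cdot>\<^bsub>D\<^esub> (FArr F f \<cdot>\<^bsub>D\<^esub> s X)"
      using a[OF s(1)[OF XY(1)] Ff component[OF XY(2)]]
        a[OF F.target.comp_closed[OF s(1)[OF XY(1)] Ff] component[OF XY(2)] s(1)[OF XY(2)]]
      by simp
    also have "\<dots> = FArr F f \<cdot>\<^bsub>D\<^esub> s X"
      using s(2)[OF XY(2)] F.target.comp_ident_left[OF F.target.comp_closed[OF s(1)[OF XY(1)] Ff]]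
      by simp
    finally show "s Y \<cdot>\<^bsub>D\<^esub> FArr G f = FArr F f \<cdot>\<^bsub>D\<^esub> s X" .
  qed
qed

lemma nat_iso_trans:
  assumes "nat_iso C D F G \<sigma>" "nat_iso C D G H \<tau>"
  shows "nat_iso C D F H (\<lambda>X. \<tau> X \<cdot>\<^bsub>D\<^esub> \<sigma> X)"
proof -
  interpret s: nat_iso C D F G \<sigma> by fact
  interpret t: nat_iso C D G H \<tau> by fact
  note a = s.F.target.comp_assoc
  show ?thesis
  proof unfold_locales
    fix X assume X: "X \<in> Obj C"
    show "\<tau> X \<cdot>\<^bsub>D\<^esub> \<sigma> X \<in> Hom D (FObj F X) (FObj H X)"
      using s.F.target.comp_closed[OF s.component[OF X] t.component[OF X]] .
    show "iso_arr D (\<tau> X \<cdot>\<^bsub>D\<^esub> \<sigma> X)"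
      using s.F.target.iso_arr_comp[OF s.component[OF X] t.component[OF X]]
        s.component_iso[OF X] t.component_iso[OF X] by blast
  next
    fix f X Y assume f: "f \<in> Hom C X Y"
    note XY = s.F.source.Hom_obj[OF f]
    note s = s.component[OF XY(1)] s.component[OF XY(2)]
    note t = t.component[OF XY(1)] t.component[OF XY(2)]
    show "(\<tau> Y \<cdot>\<^bsub>D\<^esub> \<sigma> Y) \<cdot>\<^bsub>D\<^esub> FArr F f = FArr H f \<cdot>\<^bsub>D\<^esub> (\<tau> X \<cdot>\<^bsub>D\<^esub> \<sigma> X)"
      using a[OF s.F.arr_closed[OF f] s(2) t(2)] s.naturality[OF f]
        a[OF s(1) s.G.arr_closed[OF f] t(2)] t.naturality[OF f] a[OF s(1) t(1) t.G.arr_closed[OF f]]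
      by simp
  qed
qed

lemma nat_isomorphic_trans [trans]:
  "nat_isomorphic C D F G \<Longrightarrow> nat_isomorphic C D G H \<Longrightarrow> nat_isomorphic C D F H"
  using nat_iso_trans unfolding nat_isomorphic_def by blast

lemma nat_iso_whisker_left:
  assumes "nat_iso C D F G \<tau>" "is_functor D E H"
  shows "nat_iso C E (H \<circ>\<^sub>F F) (H \<circ>\<^sub>F G) (\<lambda>X. FArr H (\<tau> X))"
proof -
  interpret t: nat_iso C D F G \<tau> by fact
  interpret H: is_functor D E H by fact
  interpret HF: is_functor C E "H \<circ>\<^sub>F F" by (rule is_functor_comp) unfold_locales
  interpret HG: is_functor C E "H \<circ>\<^sub>F G" by (rule is_functor_comp) unfold_locales
  show ?thesis
  proof unfold_locales
    fix X assume X: "X \<in> Obj C"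
    show "FArr H (\<tau> X) \<in> Hom E (FObj (H \<circ>\<^sub>F F) X) (FObj (H \<circ>\<^sub>F G) X)"
      using H.arr_closed[OF t.component[OF X]] by simp
    show "iso_arr E (FArr H (\<tau> X))"
      using H.preserves_iso[OF t.component[OF X] t.component_iso[OF X]] .
  next
    fix f X Y assume f: "f \<in> Hom C X Y"
    note XY = t.F.source.Hom_obj[OF f]
    show "FArr H (\<tau> Y) \<cdot>\<^bsub>E\<^esub> FArr (H \<circ>\<^sub>F F) f = FArr (H \<circ>\<^sub>F G) f \<cdot>\<^bsub>E\<^esub> FArr H (\<tau> X)"
      using H.preserves_comp[OF t.F.arr_closed[OF f] t.component[OF XY(2)]]
        H.preserves_comp[OF t.component[OF XY(1)] t.G.arr_closed[OF f]] t.naturality[OF f] by simp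
  qed
qed

lemma nat_iso_whisker_right:
  assumes "nat_iso D E F G \<tau>" "is_functor C D H"
  shows "nat_iso C E (F \<circ>\<^sub>F H) (G \<circ>\<^sub>F H) (\<lambda>X. \<tau> (FObj H X))"
proof -
  interpret t: nat_iso D E F G \<tau> by fact
  interpret H: is_functor C D H by fact
  interpret FH: is_functor C E "F \<circ>\<^sub>F H" by (rule is_functor_comp) unfold_locales
  interpret GH: is_functor C E "G \<circ>\<^sub>F H" by (rule is_functor_comp) unfold_locales
  show ?thesis
    by unfold_locales
      (auto intro: t.component t.component_iso t.naturality H.obj_closed H.arr_closed)
qed

lemma nat_isomorphic_whisker_left:
  "nat_isomorphic C D F G \<Longrightarrow> is_functor D E H \<Longrightarrow> nat_isomorphic C E (H \<circ>\<^sub>F F) (H \<circ>\<^sub>F G)"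
  using nat_iso_whisker_left unfolding nat_isomorphic_def by blast

lemma nat_isomorphic_whisker_right:
  "nat_isomorphic D E F G \<Longrightarrow> is_functor C D H \<Longrightarrow> nat_isomorphic C E (F \<circ>\<^sub>F H) (G \<circ>\<^sub>F H)"
  using nat_iso_whisker_right unfolding nat_isomorphic_def by blast

section \<open>Duality\<close>

text \<open>A \<open>cfunctor\<close> only records its action on objects and arrows, so a functor between opposite
  categories is literally the same datum. This makes every dual statement an instance of the original.\<close>

definition opposite :: "('o, 'm, 'z) cat_scheme \<Rightarrow> ('o, 'm, 'z) cat_scheme" where
  "opposite C = C\<lparr>Dom := Cod C, Cod := Dom C, Comp := \<lambda>g f. f \<cdot>\<^bsub>C\<^esub> g\<rparr>"

lemma opposite_simps [simp]:
  "Obj (opposite C) = Obj C" "Arr (opposite C) = Arr C"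
  "Dom (opposite C) = Cod C" "Cod (opposite C) = Dom C"
  "Ident (opposite C) = Ident C" "g \<cdot>\<^bsub>opposite C\<^esub> f = f \<cdot>\<^bsub>C\<^esub> g"
  "Hom (opposite C) X Y = Hom C Y X"
  by (auto simp: opposite_def Hom_def)

lemma opposite_opposite [simp]: "opposite (opposite C) = C"
  by (cases C) (simp add: opposite_def)

lemma category_opposite:
  assumes "category C"
  shows "category (opposite C)"
proof -
  interpret category C by fact
  show ?thesis
    by unfold_locales
      (auto intro: dom_closed cod_closed ident_closed comp_closed comp_ident_left comp_ident_right
        comp_assoc[symmetric])
qed

lemma is_functor_opposite:
  assumes "is_functor C D F"
  shows "is_functor (opposite C) (opposite D) F"
proof -
  interpret is_functor C D F by fact
  show ?thesis
    by (intro is_functor.intro category_opposite is_functor_axioms.intro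
        source.category_axioms target.category_axioms)
      (auto intro: obj_closed arr_closed preserves_ident preserves_comp)
qed

lemma nat_trans_opposite:
  assumes "nat_trans C D F G \<tau>"
  shows "nat_trans (opposite C) (opposite D) G F \<tau>"
proof -
  interpret nat_trans C D F G \<tau> by fact
  show ?thesis
    by (intro nat_trans.intro is_functor_opposite nat_trans_axioms.intro
        F.is_functor_axioms G.is_functor_axioms)
      (auto intro: component naturality[symmetric])
qed

lemma iso_arr_opposite: "iso_arr C f \<Longrightarrow> iso_arr (opposite C) f"
  unfolding iso_arr_def by auto

lemma nat_isomorphic_opposite:
  "nat_isomorphic C D F G \<Longrightarrow> nat_isomorphic (opposite C) (opposite D) G F"
  unfolding nat_isomorphic_def nat_iso_def nat_iso_axioms_def
  using nat_trans_opposite iso_arr_opposite opposite_simps(1) by metis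

lemma nat_isomorphic_opposite_iff:
  "nat_isomorphic (opposite C) (opposite D) F G \<longleftrightarrow> nat_isomorphic C D F G"
  using nat_isomorphic_opposite nat_isomorphic_sym opposite_opposite by metis

lemma equivalence_of_categories_opposite:
  "equivalence_of_categories C D F \<Longrightarrow> equivalence_of_categories (opposite C) (opposite D) F"
  unfolding equivalence_of_categories_def nat_isomorphic_opposite_iff
  by (auto dest: is_functor_opposite)

lemma adjunction_opposite:
  assumes "adjunction C D L R \<eta> \<epsilon>"
  shows "adjunction (opposite D) (opposite C) R L \<epsilon> \<eta>"
proof -
  interpret adjunction C D L R \<eta> \<epsilon> by fact
  show ?thesis
    by (intro adjunction.intro is_functor_opposite nat_trans_opposite adjunction_axioms.intro
        L.is_functor_axioms R.is_functor_axioms unit.nat_trans_axioms counit.nat_trans_axioms)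
      (auto intro: triangle_left triangle_right)
qed

lemma (in category) precompose_iso_bij:
  assumes "s \<in> Hom C X Y" "iso_arr C s"
  shows "bij_betw (\<lambda>h. h \<cdot> s) (Hom C Y Z) (Hom C X Z)"
  using category.postcompose_iso_bij[OF category_opposite[OF category_axioms], of s Y X Z]
    assms(1) iso_arr_opposite[OF assms(2)] by simp

section \<open>Right adjoints\<close>

text \<open>Adjointness through a universal counit: every \<open>h : L X \<rightarrow> Y\<close> factors uniquely as
  \<open>e Y \<cdot> L k\<close>. In this form adjoints compose by composing bijections, and a quasi-inverse is
  an adjoint without correcting its unit.\<close>

definition is_right_adjoint ::
    "('o, 'm, 'y) cat_scheme \<Rightarrow> ('p, 'n, 'z) cat_scheme \<Rightarrow>
     ('o, 'm, 'p, 'n) cfunctor \<Rightarrow> ('p, 'n, 'o, 'm) cfunctor \<Rightarrow> bool" where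
  "is_right_adjoint C D L R \<longleftrightarrow> is_functor C D L \<and> is_functor D C R \<and>
    (\<exists>e. nat_trans D D (L \<circ>\<^sub>F R) id_functor e \<and>
      (\<forall>X \<in> Obj C. \<forall>Y \<in> Obj D.
        bij_betw (\<lambda>k. e Y \<cdot>\<^bsub>D\<^esub> FArr L k) (Hom C X (FObj R Y)) (Hom D (FObj L X) Y)))"

text \<open>The inverse of \<open>k \<mapsto> \<epsilon> Y \<cdot> L k\<close> is \<open>h \<mapsto> R h \<cdot> \<eta> X\<close>; each triangle identity gives one of the two
  round trips.\<close>

lemma adjunction_is_right_adjoint:
  assumes "adjunction C D L R \<eta> \<epsilon>"
  shows "is_right_adjoint C D L R"
proof -
  interpret adjunction C D L R \<eta> \<epsilon> by fact
  note ac = L.source.comp_assoc and ad = L.target.comp_assoc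
  have "bij_betw (\<lambda>k. \<epsilon> Y \<cdot>\<^bsub>D\<^esub> FArr L k) (Hom C X (FObj R Y)) (Hom D (FObj L X) Y)"
    if X: "X \<in> Obj C" and Y: "Y \<in> Obj D" for X Y
  proof (rule bij_betw_byWitness[where f' = "\<lambda>h. FArr R h \<cdot>\<^bsub>C\<^esub> \<eta> X"])
    note \<epsilon>Y = counit.component[OF Y, simplified] and \<eta>X = unit.component[OF X, simplified]
    show "\<forall>k\<in>Hom C X (FObj R Y). FArr R (\<epsilon> Y \<cdot>\<^bsub>D\<^esub> FArr L k) \<cdot>\<^bsub>C\<^esub> \<eta> X = k"
    proof
      fix k assume k: "k \<in> Hom C X (FObj R Y)"
      note RY = R.obj_closed[OF Y]
      have "FArr R (\<epsilon> Y \<cdot>\<^bsub>D\<^esub> FArr L k) \<cdot>\<^bsub>C\<^esub> \<eta> X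
          = FArr R (\<epsilon> Y) \<cdot>\<^bsub>C\<^esub> (\<eta> (FObj R Y) \<cdot>\<^bsub>C\<^esub> k)"
        using R.preserves_comp[OF L.arr_closed[OF k] \<epsilon>Y] unit.naturality[OF k]
          ac[OF \<eta>X R.arr_closed[OF L.arr_closed[OF k]] R.arr_closed[OF \<epsilon>Y]] by simp
      also have "\<dots> = k"
        using ac[OF k unit.component[OF RY, simplified] R.arr_closed[OF \<epsilon>Y]] triangle_right[OF Y]
          L.source.comp_ident_left[OF k] by simp
      finally show "FArr R (\<epsilon> Y \<cdot>\<^bsub>D\<^esub> FArr L k) \<cdot>\<^bsub>C\<^esub> \<eta> X = k" .
    qed
    show "\<forall>h\<in>Hom D (FObj L X) Y. \<epsilon> Y \<cdot>\<^bsub>D\<^esub> FArr L (FArr R h \<cdot>\<^bsub>C\<^esub> \<eta> X) = h"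
    proof
      fix h assume h: "h \<in> Hom D (FObj L X) Y"
      note LX = L.obj_closed[OF X]
      have "\<epsilon> Y \<cdot>\<^bsub>D\<^esub> FArr L (FArr R h \<cdot>\<^bsub>C\<^esub> \<eta> X)
          = (h \<cdot>\<^bsub>D\<^esub> \<epsilon> (FObj L X)) \<cdot>\<^bsub>D\<^esub> FArr L (\<eta> X)"
        using L.preserves_comp[OF \<eta>X R.arr_closed[OF h]] counit.naturality[OF h]
          ad[OF L.arr_closed[OF \<eta>X] L.arr_closed[OF R.arr_closed[OF h]] \<epsilon>Y] by simp
      also have "\<dots> = h"
        using ad[OF L.arr_closed[OF \<eta>X] counit.component[OF LX, simplified] h] triangle_left[OF X]
          L.target.comp_ident_right[OF h] by simp
      finally show "\<epsilon> Y \<cdot>\<^bsub>D\<^esub> FArr L (FArr R h \<cdot>\<^bsub>C\<^esub> \<eta> X) = h" .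
    qed
  qed (use L.source.comp_closed[OF unit.component[OF X, simplified] R.arr_closed]
      L.target.comp_closed[OF L.arr_closed counit.component[OF Y, simplified]] in auto)
  then show ?thesis
    unfolding is_right_adjoint_def
    using L.is_functor_axioms R.is_functor_axioms counit.nat_trans_axioms by blast
qed

text \<open>Each counit factors through the other by universality. The factorisations are mutually inverse
  and natural because any two arrows with the same composite with a counit are equal.\<close>

lemma right_adjoint_unique:
  assumes "is_right_adjoint C D L R" "is_right_adjoint C D L R'"
  shows "nat_isomorphic D C R R'"
proof -
  obtain e where "nat_trans D D (L \<circ>\<^sub>F R) id_functor e"
    and e: "\<And>X Y. X \<in> Obj C \<Longrightarrow> Y \<in> Obj D \<Longrightarrow>
      bij_betw (\<lambda>k. e Y \<cdot>\<^bsub>D\<^esub> FArr L k) (Hom C X (FObj R Y)) (Hom D (FObj L X) Y)"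
    and LR: "is_functor C D L" "is_functor D C R"
    using assms(1) unfolding is_right_adjoint_def by blast
  interpret L: is_functor C D L by fact
  interpret R: is_functor D C R by fact
  interpret e: nat_trans D D "L \<circ>\<^sub>F R" id_functor e by fact
  obtain e' where "nat_trans D D (L \<circ>\<^sub>F R') id_functor e'"
    and e': "\<And>X Y. X \<in> Obj C \<Longrightarrow> Y \<in> Obj D \<Longrightarrow>
      bij_betw (\<lambda>k. e' Y \<cdot>\<^bsub>D\<^esub> FArr L k) (Hom C X (FObj R' Y)) (Hom D (FObj L X) Y)"
    and R': "is_functor D C R'"
    using assms(2) unfolding is_right_adjoint_def by blast
  interpret R': is_functor D C R' by fact
  interpret e': nat_trans D D "L \<circ>\<^sub>F R'" id_functor e' by fact
  note ec = e.component[simplified] and ec' = e'.component[simplified]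
  have "\<forall>Y\<in>Obj D. \<exists>a. a \<in> Hom C (FObj R Y) (FObj R' Y) \<and> e' Y \<cdot>\<^bsub>D\<^esub> FArr L a = e Y"
    using bij_betw_imp_surj_on[OF e'[OF R.obj_closed]] ec by (metis imageE)
  then obtain a where a: "\<And>Y. Y \<in> Obj D \<Longrightarrow> a Y \<in> Hom C (FObj R Y) (FObj R' Y)"
      "\<And>Y. Y \<in> Obj D \<Longrightarrow> e' Y \<cdot>\<^bsub>D\<^esub> FArr L (a Y) = e Y"
    by metis
  have "\<forall>Y\<in>Obj D. \<exists>b. b \<in> Hom C (FObj R' Y) (FObj R Y) \<and> e Y \<cdot>\<^bsub>D\<^esub> FArr L b = e' Y"
    using bij_betw_imp_surj_on[OF e[OF R'.obj_closed]] ec' by (metis imageE)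
  then obtain b where b: "\<And>Y. Y \<in> Obj D \<Longrightarrow> b Y \<in> Hom C (FObj R' Y) (FObj R Y)"
      "\<And>Y. Y \<in> Obj D \<Longrightarrow> e Y \<cdot>\<^bsub>D\<^esub> FArr L (b Y) = e' Y"
    by metis
  have factor: "e' Y \<cdot>\<^bsub>D\<^esub> FArr L (a Y \<cdot>\<^bsub>C\<^esub> k) = e Y \<cdot>\<^bsub>D\<^esub> FArr L k"
    if "Y \<in> Obj D" "k \<in> Hom C X (FObj R Y)" for X Y k
    using L.preserves_comp[OF that(2) a(1)] a(2)
      L.target.comp_assoc[OF L.arr_closed[OF that(2)] L.arr_closed[OF a(1)] ec'] that by simp
  have factor': "e Y \<cdot>\<^bsub>D\<^esub> FArr L (b Y \<cdot>\<^bsub>C\<^esub> k) = e' Y \<cdot>\<^bsub>D\<^esub> FArr L k"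
    if "Y \<in> Obj D" "k \<in> Hom C X (FObj R' Y)" for X Y k
    using L.preserves_comp[OF that(2) b(1)] b(2)
      L.target.comp_assoc[OF L.arr_closed[OF that(2)] L.arr_closed[OF b(1)] ec] that by simp
  have cancel: "k = k'" if "Y \<in> Obj D" "k \<in> Hom C X (FObj R Y)" "k' \<in> Hom C X (FObj R Y)"
      "e Y \<cdot>\<^bsub>D\<^esub> FArr L k = e Y \<cdot>\<^bsub>D\<^esub> FArr L k'" for X Y k k'
    using inj_onD[OF bij_betw_imp_inj_on[OF e]] that L.source.Hom_obj(1) by metis
  have cancel': "k = k'" if "Y \<in> Obj D" "k \<in> Hom C X (FObj R' Y)" "k' \<in> Hom C X (FObj R' Y)"
      "e' Y \<cdot>\<^bsub>D\<^esub> FArr L k = e' Y \<cdot>\<^bsub>D\<^esub> FArr L k'" for X Y k k'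
    using inj_onD[OF bij_betw_imp_inj_on[OF e']] that L.source.Hom_obj(1) by metis
  show ?thesis
  proof (rule nat_isomorphicI[OF LR(2) R' a(1)])
    fix Y assume Y: "Y \<in> Obj D"
    show "iso_arr C (a Y)"
    proof (rule iso_arrI[OF a(1)[OF Y] b(1)[OF Y]])
      show "b Y \<cdot>\<^bsub>C\<^esub> a Y = Ident C (FObj R Y)"
        by (rule cancel[OF Y])
          (use factor'[OF Y a(1)[OF Y]] a(2)[OF Y] L.source.comp_closed[OF a(1)[OF Y] b(1)[OF Y]]
            L.source.ident_closed[OF R.obj_closed[OF Y]] L.preserves_ident[OF R.obj_closed[OF Y]]
            L.target.comp_ident_right[OF ec[OF Y]] in auto)
      show "a Y \<cdot>\<^bsub>C\<^esub> b Y = Ident C (FObj R' Y)"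
        by (rule cancel'[OF Y])
          (use factor[OF Y b(1)[OF Y]] b(2)[OF Y] L.source.comp_closed[OF b(1)[OF Y] a(1)[OF Y]]
            L.source.ident_closed[OF R'.obj_closed[OF Y]] L.preserves_ident[OF R'.obj_closed[OF Y]]
            L.target.comp_ident_right[OF ec'[OF Y]] in auto)
    qed
  next
    fix X Y f assume f: "f \<in> Hom D X Y"
    note XY = L.target.Hom_obj[OF f]
    note Rf = R.arr_closed[OF f] and R'f = R'.arr_closed[OF f]
    have "e' Y \<cdot>\<^bsub>D\<^esub> FArr L (a Y \<cdot>\<^bsub>C\<^esub> FArr R f) = f \<cdot>\<^bsub>D\<^esub> e X"
      using factor[OF XY(2) Rf] e.naturality[OF f] by simp
    also have "\<dots> = e' Y \<cdot>\<^bsub>D\<^esub> FArr L (FArr R' f \<cdot>\<^bsub>C\<^esub> a X)"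
      using a(2)[OF XY(1)] e'.naturality[OF f] L.preserves_comp[OF a(1)[OF XY(1)] R'f]
        L.target.comp_assoc[OF L.arr_closed[OF a(1)[OF XY(1)]] ec'[OF XY(1)] f]
        L.target.comp_assoc[OF L.arr_closed[OF a(1)[OF XY(1)]] L.arr_closed[OF R'f] ec'[OF XY(2)]]
      by simp
    finally show "a Y \<cdot>\<^bsub>C\<^esub> FArr R f = FArr R' f \<cdot>\<^bsub>C\<^esub> a X"
      using cancel'[OF XY(2)] L.source.comp_closed[OF Rf a(1)[OF XY(2)]]
        L.source.comp_closed[OF a(1)[OF XY(1)] R'f] by blast
  qed
qed

lemma right_adjoint_comp:
  assumes "is_right_adjoint C D L R" "is_right_adjoint D E F G"
  shows "is_right_adjoint C E (F \<circ>\<^sub>F L) (R \<circ>\<^sub>F G)"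
proof -
  obtain e where "nat_trans D D (L \<circ>\<^sub>F R) id_functor e"
    and e: "\<And>X Y. X \<in> Obj C \<Longrightarrow> Y \<in> Obj D \<Longrightarrow>
      bij_betw (\<lambda>k. e Y \<cdot>\<^bsub>D\<^esub> FArr L k) (Hom C X (FObj R Y)) (Hom D (FObj L X) Y)"
    and LR: "is_functor C D L" "is_functor D C R"
    using assms(1) unfolding is_right_adjoint_def by blast
  obtain d where "nat_trans E E (F \<circ>\<^sub>F G) id_functor d"
    and d: "\<And>X Y. X \<in> Obj D \<Longrightarrow> Y \<in> Obj E \<Longrightarrow>
      bij_betw (\<lambda>k. d Y \<cdot>\<^bsub>E\<^esub> FArr F k) (Hom D X (FObj G Y)) (Hom E (FObj F X) Y)"
    and FG: "is_functor D E F" "is_functor E D G"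
    using assms(2) unfolding is_right_adjoint_def by blast
  interpret L: is_functor C D L by fact
  interpret R: is_functor D C R by fact
  interpret F: is_functor D E F by fact
  interpret G: is_functor E D G by fact
  interpret e: nat_trans D D "L \<circ>\<^sub>F R" id_functor e by fact
  interpret d: nat_trans E E "F \<circ>\<^sub>F G" id_functor d by fact
  note ec = e.component[simplified] and dc = d.component[simplified]
  define c where "c Z = d Z \<cdot>\<^bsub>E\<^esub> FArr F (e (FObj G Z))" for Z
  have Fe: "FArr F (e (FObj G Z)) \<in> Hom E (FObj F (FObj L (FObj R (FObj G Z)))) (FObj F (FObj G Z))"
    if "Z \<in> Obj E" for Z
    using F.arr_closed[OF ec[OF G.obj_closed[OF that]]] .
  have cc: "c Z \<in> Hom E (FObj F (FObj L (FObj R (FObj G Z)))) Z" if "Z \<in> Obj E" for Z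
    unfolding c_def using F.target.comp_closed[OF Fe dc] that by blast
  have "nat_trans E E ((F \<circ>\<^sub>F L) \<circ>\<^sub>F (R \<circ>\<^sub>F G)) id_functor c"
  proof (intro nat_trans.intro nat_trans_axioms.intro)
    show "is_functor E E ((F \<circ>\<^sub>F L) \<circ>\<^sub>F (R \<circ>\<^sub>F G))"
      by (rule is_functor_comp[OF is_functor_comp[OF FG(2) LR(2)] is_functor_comp[OF LR(1) FG(1)]])
    show "is_functor E E id_functor" by unfold_locales
    fix f X Y assume f: "f \<in> Hom E X Y"
    note XY = F.target.Hom_obj[OF f]
    note Gf = G.arr_closed[OF f]
    note FLRGf = F.arr_closed[OF L.arr_closed[OF R.arr_closed[OF Gf]]]
    have "c Y \<cdot>\<^bsub>E\<^esub> FArr F (FArr L (FArr R (FArr G f)))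
        = d Y \<cdot>\<^bsub>E\<^esub> FArr F (e (FObj G Y) \<cdot>\<^bsub>D\<^esub> FArr L (FArr R (FArr G f)))"
      unfolding c_def
      using F.target.comp_assoc[OF FLRGf Fe[OF XY(2)] dc[OF XY(2)]]
        F.preserves_comp[OF L.arr_closed[OF R.arr_closed[OF Gf]] ec[OF G.obj_closed[OF XY(2)]]]
      by simp
    also have "\<dots> = d Y \<cdot>\<^bsub>E\<^esub> (FArr F (FArr G f) \<cdot>\<^bsub>E\<^esub> FArr F (e (FObj G X)))"
      using e.naturality[OF Gf] F.preserves_comp[OF ec[OF G.obj_closed[OF XY(1)]] Gf] by simp
    also have "\<dots> = f \<cdot>\<^bsub>E\<^esub> c X"
      unfolding c_def
      using F.target.comp_assoc[OF Fe[OF XY(1)] F.arr_closed[OF Gf] dc[OF XY(2)]]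
        F.target.comp_assoc[OF Fe[OF XY(1)] dc[OF XY(1)] f] d.naturality[OF f] by simp
    finally show "c Y \<cdot>\<^bsub>E\<^esub> FArr ((F \<circ>\<^sub>F L) \<circ>\<^sub>F (R \<circ>\<^sub>F G)) f = FArr id_functor f \<cdot>\<^bsub>E\<^esub> c X"
      by simp
  qed (use cc in simp)
  moreover have "bij_betw (\<lambda>k. c Z \<cdot>\<^bsub>E\<^esub> FArr (F \<circ>\<^sub>F L) k)
      (Hom C X (FObj (R \<circ>\<^sub>F G) Z)) (Hom E (FObj (F \<circ>\<^sub>F L) X) Z)"
    if X: "X \<in> Obj C" and Z: "Z \<in> Obj E" for X Z
  proof -
    note GZ = G.obj_closed[OF Z]
    have eq: "((\<lambda>m. d Z \<cdot>\<^bsub>E\<^esub> FArr F m) \<circ> (\<lambda>k. e (FObj G Z) \<cdot>\<^bsub>D\<^esub> FArr L k)) k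
        = c Z \<cdot>\<^bsub>E\<^esub> FArr (F \<circ>\<^sub>F L) k" if k: "k \<in> Hom C X (FObj R (FObj G Z))" for k
      unfolding c_def
      using F.preserves_comp[OF L.arr_closed[OF k] ec[OF GZ]]
        F.target.comp_assoc[OF F.arr_closed[OF L.arr_closed[OF k]] Fe[OF Z] dc[OF Z]] by simp
    show ?thesis
      unfolding FObj_comp
      using bij_betw_trans[OF e[OF X GZ] d[OF L.obj_closed[OF X] Z]]
      by (rule bij_betw_cong[THEN iffD1, rotated]) (rule eq)
  qed
  ultimately show ?thesis
    unfolding is_right_adjoint_def
    using is_functor_comp[OF LR(1) FG(1)] is_functor_comp[OF FG(2) LR(2)] by blast
qed

text \<open>For \<open>s : L' \<cong> L\<close> the counit of the new adjunction is the old one precomposed with \<open>s\<close>, and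
  the new hom bijection is the old one followed by precomposition with the isomorphism \<open>s X\<close>.\<close>

lemma right_adjoint_cong_left:
  assumes "is_right_adjoint C D L R" "nat_isomorphic C D L L'"
  shows "is_right_adjoint C D L' R"
proof -
  obtain e where "nat_trans D D (L \<circ>\<^sub>F R) id_functor e"
    and e: "\<And>X Y. X \<in> Obj C \<Longrightarrow> Y \<in> Obj D \<Longrightarrow>
      bij_betw (\<lambda>k. e Y \<cdot>\<^bsub>D\<^esub> FArr L k) (Hom C X (FObj R Y)) (Hom D (FObj L X) Y)"
    and R: "is_functor D C R"
    using assms(1) unfolding is_right_adjoint_def by blast
  obtain s where "nat_iso C D L' L s"
    using nat_isomorphic_sym[OF assms(2)] by (rule nat_isomorphicE)
  then interpret s: nat_iso C D L' L s .
  interpret R: is_functor D C R by fact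
  interpret e: nat_trans D D "L \<circ>\<^sub>F R" id_functor e by fact
  note ec = e.component[simplified] and a = s.F.target.comp_assoc
  define c where "c Y = e Y \<cdot>\<^bsub>D\<^esub> s (FObj R Y)" for Y
  have sR: "s (FObj R Y) \<in> Hom D (FObj L' (FObj R Y)) (FObj L (FObj R Y))" if "Y \<in> Obj D" for Y
    using s.component[OF R.obj_closed[OF that]] .
  have move: "c Y \<cdot>\<^bsub>D\<^esub> FArr L' k = (e Y \<cdot>\<^bsub>D\<^esub> FArr L k) \<cdot>\<^bsub>D\<^esub> s X"
    if Y: "Y \<in> Obj D" and k: "k \<in> Hom C X (FObj R Y)" for X Y k
    unfolding c_def
    using a[OF s.F.arr_closed[OF k] sR[OF Y] ec[OF Y]] s.naturality[OF k]
      a[OF s.component[OF s.F.source.Hom_obj(1)[OF k]] s.G.arr_closed[OF k] ec[OF Y]] by simp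
  have "nat_trans D D (L' \<circ>\<^sub>F R) id_functor c"
  proof (intro nat_trans.intro nat_trans_axioms.intro)
    show "is_functor D D (L' \<circ>\<^sub>F R)"
      by (rule is_functor_comp) unfold_locales
    show "is_functor D D id_functor" by unfold_locales
    show "c Y \<in> Hom D (FObj (L' \<circ>\<^sub>F R) Y) (FObj id_functor Y)" if "Y \<in> Obj D" for Y
      unfolding c_def using s.F.target.comp_closed[OF sR ec] that by simp
    fix f X Y assume f: "f \<in> Hom D X Y"
    note XY = s.F.target.Hom_obj[OF f]
    show "c Y \<cdot>\<^bsub>D\<^esub> FArr (L' \<circ>\<^sub>F R) f = FArr id_functor f \<cdot>\<^bsub>D\<^esub> c X"
      using move[OF XY(2) R.arr_closed[OF f]] e.naturality[OF f] a[OF sR[OF XY(1)] ec[OF XY(1)] f]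
      by (simp add: c_def)
  qed
  moreover have "bij_betw (\<lambda>k. c Y \<cdot>\<^bsub>D\<^esub> FArr L' k) (Hom C X (FObj R Y)) (Hom D (FObj L' X) Y)"
    if X: "X \<in> Obj C" and Y: "Y \<in> Obj D" for X Y
  proof -
    have eq: "((\<lambda>h. h \<cdot>\<^bsub>D\<^esub> s X) \<circ> (\<lambda>k. e Y \<cdot>\<^bsub>D\<^esub> FArr L k)) k = c Y \<cdot>\<^bsub>D\<^esub> FArr L' k"
      if "k \<in> Hom C X (FObj R Y)" for k
      using move[OF Y that] by simp
    show ?thesis
      using bij_betw_trans[OF e[OF X Y]
          s.F.target.precompose_iso_bij[OF s.component[OF X] s.component_iso[OF X]]]
      by (rule bij_betw_cong[THEN iffD1, rotated]) (rule eq)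
  qed
  ultimately show ?thesis
    unfolding is_right_adjoint_def using s.F.is_functor_axioms R by blast
qed

lemma faithful_if_retraction:
  assumes "nat_isomorphic C C (G \<circ>\<^sub>F F) id_functor"
    and "f \<in> Hom C X Y" "f' \<in> Hom C X Y" "FArr G (FArr F f) = FArr G (FArr F f')"
  shows "f = f'"
proof -
  obtain \<tau> where "nat_iso C C (G \<circ>\<^sub>F F) id_functor \<tau>" using assms(1) by (rule nat_isomorphicE)
  then interpret nat_iso C C "G \<circ>\<^sub>F F" id_functor \<tau> .
  note X = F.source.Hom_obj(1)[OF assms(2)]
  have "f \<cdot>\<^bsub>C\<^esub> \<tau> X = f' \<cdot>\<^bsub>C\<^esub> \<tau> X"
    using naturality[OF assms(2)] naturality[OF assms(3)] assms(4) by simp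
  moreover have "inj_on (\<lambda>h. h \<cdot>\<^bsub>C\<^esub> \<tau> X) (Hom C X Y)"
    using F.source.precompose_iso_bij[OF component[OF X] component_iso[OF X]]
    by (simp add: bij_betw_def)
  ultimately show ?thesis
    using assms(2,3) by (auto dest: inj_onD)
qed

text \<open>For fullness, conjugating \<open>G h\<close> by the isomorphism \<open>G F \<cong> id\<close> yields an arrow \<open>k\<close> with
  \<open>G (F k) = G h\<close>, and \<open>G\<close> is faithful because \<open>F G \<cong> id\<close>.\<close>

lemma equivalence_fully_faithful:
  assumes "is_functor C D F" "is_functor D C G"
    and GF: "nat_isomorphic C C (G \<circ>\<^sub>F F) id_functor"
    and FG: "nat_isomorphic D D (F \<circ>\<^sub>F G) id_functor"
  shows "fully_faithful C D F"
proof -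
  interpret F: is_functor C D F by fact
  interpret G: is_functor D C G by fact
  obtain \<tau> where "nat_iso C C (G \<circ>\<^sub>F F) id_functor \<tau>" using GF by (rule nat_isomorphicE)
  then interpret t: nat_iso C C "G \<circ>\<^sub>F F" id_functor \<tau> .
  have "bij_betw (FArr F) (Hom C X Y) (Hom D (FObj F X) (FObj F Y))"
    if X: "X \<in> Obj C" and Y: "Y \<in> Obj C" for X Y
    unfolding bij_betw_def
  proof (intro conjI inj_onI equalityI subsetI)
    fix f f' assume "f \<in> Hom C X Y" "f' \<in> Hom C X Y" "FArr F f = FArr F f'"
    then show "f = f'" using faithful_if_retraction[OF GF] by metis
  next
    fix h assume "h \<in> FArr F ` Hom C X Y"
    then show "h \<in> Hom D (FObj F X) (FObj F Y)" using F.arr_closed by blast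
  next
    fix h assume h: "h \<in> Hom D (FObj F X) (FObj F Y)"
    note tX = t.component[OF X, simplified] and tY = t.component[OF Y, simplified]
    have tYh: "\<tau> Y \<cdot>\<^bsub>C\<^esub> FArr G h \<in> Hom C (FObj G (FObj F X)) Y"
      using F.source.comp_closed[OF G.arr_closed[OF h] tY] .
    then obtain k where k: "k \<in> Hom C X Y" "k \<cdot>\<^bsub>C\<^esub> \<tau> X = \<tau> Y \<cdot>\<^bsub>C\<^esub> FArr G h"
      using bij_betw_imp_surj_on[OF F.source.precompose_iso_bij[OF tX t.component_iso[OF X], of Y]]
      by (metis (no_types, lifting) imageE)
    have "\<tau> Y \<cdot>\<^bsub>C\<^esub> FArr G (FArr F k) = \<tau> Y \<cdot>\<^bsub>C\<^esub> FArr G h"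
      using t.naturality[OF k(1)] k(2) by simp
    then have "FArr G (FArr F k) = FArr G h"
      using inj_onD[OF bij_betw_imp_inj_on[OF F.source.postcompose_iso_bij[OF tY t.component_iso[OF Y]]]]
        G.arr_closed[OF F.arr_closed[OF k(1)]] G.arr_closed[OF h] by blast
    then have "FArr F k = h"
      using faithful_if_retraction[OF FG F.arr_closed[OF k(1)] h] by metis
    then show "h \<in> FArr F ` Hom C X Y" using k(1) by blast
  qed
  then show ?thesis unfolding fully_faithful_def using assms(1) by blast
qed

text \<open>A quasi-inverse is right adjoint even though the given isomorphisms \<open>G F \<cong> id\<close> and
  \<open>F G \<cong> id\<close> need not satisfy the triangle identities: the second alone serves as counit, and its
  universality is the full faithfulness of \<open>F\<close>.\<close>

lemma equivalence_right_adjoint: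
  assumes "is_functor C D F" "is_functor D C G"
    and "nat_isomorphic C C (G \<circ>\<^sub>F F) id_functor"
    and FG: "nat_isomorphic D D (F \<circ>\<^sub>F G) id_functor"
  shows "is_right_adjoint C D F G"
proof -
  interpret F: is_functor C D F by fact
  interpret G: is_functor D C G by fact
  obtain e where "nat_iso D D (F \<circ>\<^sub>F G) id_functor e" using FG by (rule nat_isomorphicE)
  then interpret e: nat_iso D D "F \<circ>\<^sub>F G" id_functor e .
  have "bij_betw (\<lambda>k. e Y \<cdot>\<^bsub>D\<^esub> FArr F k) (Hom C X (FObj G Y)) (Hom D (FObj F X) Y)"
    if X: "X \<in> Obj C" and Y: "Y \<in> Obj D" for X Y
  proof -
    have "bij_betw (FArr F) (Hom C X (FObj G Y)) (Hom D (FObj F X) (FObj F (FObj G Y)))"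
      using equivalence_fully_faithful[OF assms] X G.obj_closed[OF Y]
      unfolding fully_faithful_def by blast
    moreover have "bij_betw (\<lambda>h. e Y \<cdot>\<^bsub>D\<^esub> h)
        (Hom D (FObj F X) (FObj F (FObj G Y))) (Hom D (FObj F X) Y)"
      using F.target.postcompose_iso_bij[OF e.component[OF Y] e.component_iso[OF Y]] by simp
    ultimately have "bij_betw ((\<lambda>h. e Y \<cdot>\<^bsub>D\<^esub> h) \<circ> FArr F) (Hom C X (FObj G Y)) (Hom D (FObj F X) Y)"
      by (rule bij_betw_trans)
    then show ?thesis by (simp add: comp_def)
  qed
  then show ?thesis
    unfolding is_right_adjoint_def using assms(1,2) e.nat_trans_axioms by blast
qed

section \<open>Equivalences that respect one adjoint respect the other\<close>

text \<open>With \<open>g\<close> a quasi-inverse of \<open>f\<close>, composing adjoints makes \<open>R g\<close> right adjoint to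
  \<open>f L \<cong> L'\<close>. Hence \<open>R g \<cong> R'\<close> by uniqueness, and composing with \<open>f\<close> gives the claim.\<close>

lemma right_adjoint_source_equivalence:
  assumes LR: "is_right_adjoint A C L R" and LR': "is_right_adjoint A D L' R'"
    and f: "equivalence_of_categories C D f"
    and iso: "nat_isomorphic A D (f \<circ>\<^sub>F L) L'"
  shows "nat_isomorphic C A R (R' \<circ>\<^sub>F f)"
proof -
  obtain g where g: "is_functor C D f" "is_functor D C g"
    "nat_isomorphic C C (g \<circ>\<^sub>F f) id_functor" "nat_isomorphic D D (f \<circ>\<^sub>F g) id_functor"
    using f unfolding equivalence_of_categories_def by blast
  have R: "is_functor C A R" using LR unfolding is_right_adjoint_def by blast
  have "is_right_adjoint A D L' (R \<circ>\<^sub>F g)"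
    using right_adjoint_cong_left[OF right_adjoint_comp[OF LR equivalence_right_adjoint[OF g]] iso] .
  then have "nat_isomorphic D A (R \<circ>\<^sub>F g) R'"
    using LR' by (rule right_adjoint_unique)
  then have "nat_isomorphic C A (R \<circ>\<^sub>F (g \<circ>\<^sub>F f)) (R' \<circ>\<^sub>F f)"
    using nat_isomorphic_whisker_right[OF _ g(1)] by (metis comp_functor_assoc)
  moreover have "nat_isomorphic C A R (R \<circ>\<^sub>F (g \<circ>\<^sub>F f))"
    using nat_isomorphic_sym[OF nat_isomorphic_whisker_left[OF g(3) R]] by simp
  ultimately show ?thesis by (metis nat_isomorphic_trans)
qed

text \<open>The functor \<open>g R'\<close> is right adjoint to \<open>L' f \<cong> L\<close>, so \<open>R \<cong> g R'\<close>.\<close>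

lemma right_adjoint_target_equivalence:
  assumes LR: "is_right_adjoint C A L R" and LR': "is_right_adjoint D A L' R'"
    and f: "equivalence_of_categories C D f"
    and iso: "nat_isomorphic C A L (L' \<circ>\<^sub>F f)"
  shows "nat_isomorphic A D (f \<circ>\<^sub>F R) R'"
proof -
  obtain g where g: "is_functor C D f" "is_functor D C g"
    "nat_isomorphic C C (g \<circ>\<^sub>F f) id_functor" "nat_isomorphic D D (f \<circ>\<^sub>F g) id_functor"
    using f unfolding equivalence_of_categories_def by blast
  have R': "is_functor A D R'" using LR' unfolding is_right_adjoint_def by blast
  have "is_right_adjoint C A L (g \<circ>\<^sub>F R')"
    using right_adjoint_cong_left[OF right_adjoint_comp[OF equivalence_right_adjoint[OF g] LR']
        nat_isomorphic_sym[OF iso]] .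
  with LR have "nat_isomorphic A C R (g \<circ>\<^sub>F R')"
    by (rule right_adjoint_unique)
  then have "nat_isomorphic A D (f \<circ>\<^sub>F R) ((f \<circ>\<^sub>F g) \<circ>\<^sub>F R')"
    using nat_isomorphic_whisker_left[OF _ g(1)] by (metis comp_functor_assoc)
  moreover have "nat_isomorphic A D ((f \<circ>\<^sub>F g) \<circ>\<^sub>F R') R'"
    using nat_isomorphic_whisker_right[OF g(4) R'] by simp
  ultimately show ?thesis by (metis nat_isomorphic_trans)
qed

text \<open>Passing to opposite categories exchanges left and right adjoints, which turns the two lemmas
  above into statements about left adjoints.\<close>

lemma left_adjoint_source_equivalence:
  assumes "adjunction C A L R \<eta> \<epsilon>" and "adjunction D A L' R' \<eta>' \<epsilon>'"
    and "equivalence_of_categories C D f"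
    and "nat_isomorphic A D (f \<circ>\<^sub>F R) R'"
  shows "nat_isomorphic C A L (L' \<circ>\<^sub>F f)"
  using right_adjoint_source_equivalence[OF
      adjunction_is_right_adjoint[OF adjunction_opposite[OF assms(1)]]
      adjunction_is_right_adjoint[OF adjunction_opposite[OF assms(2)]]
      equivalence_of_categories_opposite[OF assms(3)]] assms(4)
  by (simp add: nat_isomorphic_opposite_iff)

lemma left_adjoint_target_equivalence:
  assumes "adjunction A C L R \<eta> \<epsilon>" and "adjunction A D L' R' \<eta>' \<epsilon>'"
    and "equivalence_of_categories C D f"
    and "nat_isomorphic C A R (R' \<circ>\<^sub>F f)"
  shows "nat_isomorphic A D (f \<circ>\<^sub>F L) L'"
  using right_adjoint_target_equivalence[OF
      adjunction_is_right_adjoint[OF adjunction_opposite[OF assms(1)]]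
      adjunction_is_right_adjoint[OF adjunction_opposite[OF assms(2)]]
      equivalence_of_categories_opposite[OF assms(3)]] assms(4)
  by (simp add: nat_isomorphic_opposite_iff)

section \<open>Equivalence of recollements is a preorder\<close>

lemma equivalence_of_categories_id:
  assumes "category C"
  shows "equivalence_of_categories C C id_functor"
  using is_functor_id[OF assms] nat_isomorphic_refl[OF is_functor_id[OF assms]]
  unfolding equivalence_of_categories_def by (auto intro!: exI[of _ id_functor])

lemma quasi_inverse_comp:
  assumes "is_functor C D F" "is_functor D C F'" "is_functor D E G" "is_functor E D G'"
    and F: "nat_isomorphic C C (F' \<circ>\<^sub>F F) id_functor"
    and G: "nat_isomorphic D D (G' \<circ>\<^sub>F G) id_functor"
  shows "nat_isomorphic C C ((F' \<circ>\<^sub>F G') \<circ>\<^sub>F (G \<circ>\<^sub>F F)) id_functor"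
proof -
  have "nat_isomorphic C C (F' \<circ>\<^sub>F ((G' \<circ>\<^sub>F G) \<circ>\<^sub>F F)) (F' \<circ>\<^sub>F (id_functor \<circ>\<^sub>F F))"
    by (rule nat_isomorphic_whisker_left[OF nat_isomorphic_whisker_right[OF G assms(1)] assms(2)])
  then show ?thesis
    using nat_isomorphic_trans[OF _ F] by (simp add: comp_functor_assoc)
qed

lemma equivalence_of_categories_comp:
  assumes "equivalence_of_categories C D F" "equivalence_of_categories D E G"
  shows "equivalence_of_categories C E (G \<circ>\<^sub>F F)"
proof -
  obtain F' where F: "is_functor C D F" "is_functor D C F'"
    "nat_isomorphic C C (F' \<circ>\<^sub>F F) id_functor" "nat_isomorphic D D (F \<circ>\<^sub>F F') id_functor"
    using assms(1) unfolding equivalence_of_categories_def by blast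
  obtain G' where G: "is_functor D E G" "is_functor E D G'"
    "nat_isomorphic D D (G' \<circ>\<^sub>F G) id_functor" "nat_isomorphic E E (G \<circ>\<^sub>F G') id_functor"
    using assms(2) unfolding equivalence_of_categories_def by blast
  show ?thesis
    unfolding equivalence_of_categories_def
    using is_functor_comp[OF F(1) G(1)] is_functor_comp[OF G(2) F(2)]
      quasi_inverse_comp[OF F(1,2) G(1,2) F(3) G(3)] quasi_inverse_comp[OF G(2,1) F(2,1) G(4) F(4)]
    by blast
qed

lemma exact_functor_is_functor: "exact_functor C D F \<Longrightarrow> is_functor C D F"
  unfolding exact_functor_def additive_functor_def by blast

lemma exact_functor_id:
  assumes "triangulated_category C"
  shows "exact_functor C C id_functor"
proof -
  interpret triangulated_category C by fact
  have "additive_functor C C id_functor"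
    by (intro additive_functor.intro additive_functor_axioms.intro is_functor_id)
      (unfold_locales, simp)
  moreover have "nat_iso C C (id_functor \<circ>\<^sub>F Shift C) (Shift C \<circ>\<^sub>F id_functor) (\<lambda>X. Ident C (TO C X))"
    using nat_iso_refl[OF shift.is_functor_axioms] by simp
  moreover have "Ident C (TO C X) \<cdot>\<^bsub>C\<^esub> w = w" if "dist_triangle C X Y Z (u, v, w)" for X Y Z u v w
    using that comp_ident_left unfolding dist_triangle_def triangle_def by auto
  ultimately show ?thesis
    unfolding exact_functor_def by (auto simp: dist_triangle_def)
qed

text \<open>The isomorphisms with the shifts paste to \<open>G F T \<cong> G T F \<cong> T G F\<close>. Exactness of
  \<open>G\<close> applies to the image of a triangle under \<open>F\<close> once its last arrow is corrected by \<open>\<phi> X\<close>.\<close>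

lemma exact_functor_comp:
  assumes "exact_functor C D F" "exact_functor D E G"
  shows "exact_functor C E (G \<circ>\<^sub>F F)"
proof -
  interpret F: additive_functor C D F using assms(1) unfolding exact_functor_def by blast
  interpret G: additive_functor D E G using assms(2) unfolding exact_functor_def by blast
  obtain \<phi> where \<phi>: "nat_iso C D (F \<circ>\<^sub>F Shift C) (Shift D \<circ>\<^sub>F F) \<phi>"
    and F: "\<And>X Y Z u v w. dist_triangle C X Y Z (u, v, w) \<Longrightarrow>
        (FArr F u, FArr F v, \<phi> X \<cdot>\<^bsub>D\<^esub> FArr F w) \<in> Dist D"
    using assms(1) unfolding exact_functor_def by blast
  obtain \<psi> where \<psi>: "nat_iso D E (G \<circ>\<^sub>F Shift D) (Shift E \<circ>\<^sub>F G) \<psi>"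
    and G: "\<And>X Y Z u v w. dist_triangle D X Y Z (u, v, w) \<Longrightarrow>
        (FArr G u, FArr G v, \<psi> X \<cdot>\<^bsub>E\<^esub> FArr G w) \<in> Dist E"
    using assms(2) unfolding exact_functor_def by blast
  interpret p: nat_iso C D "F \<circ>\<^sub>F Shift C" "Shift D \<circ>\<^sub>F F" \<phi> by fact
  interpret q: nat_iso D E "G \<circ>\<^sub>F Shift D" "Shift E \<circ>\<^sub>F G" \<psi> by fact
  interpret GF: is_functor C E "G \<circ>\<^sub>F F" by (rule is_functor_comp) unfold_locales
  define \<chi> where "\<chi> X = \<psi> (FObj F X) \<cdot>\<^bsub>E\<^esub> FArr G (\<phi> X)" for X
  have "additive_functor C E (G \<circ>\<^sub>F F)"
    by unfold_locales (simp add: F.preserves_plus G.preserves_plus[OF F.arr_closed F.arr_closed])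
  moreover have "nat_iso C E ((G \<circ>\<^sub>F F) \<circ>\<^sub>F Shift C) (Shift E \<circ>\<^sub>F (G \<circ>\<^sub>F F)) \<chi>"
    using nat_iso_trans[OF nat_iso_whisker_left[OF \<phi> G.is_functor_axioms, unfolded comp_functor_assoc[symmetric]]
        nat_iso_whisker_right[OF \<psi> F.is_functor_axioms]]
    unfolding \<chi>_def comp_functor_assoc .
  moreover have "(FArr (G \<circ>\<^sub>F F) u, FArr (G \<circ>\<^sub>F F) v, \<chi> X \<cdot>\<^bsub>E\<^esub> FArr (G \<circ>\<^sub>F F) w) \<in> Dist E"
    if t: "dist_triangle C X Y Z (u, v, w)" for X Y Z u v w
  proof -
    have u: "u \<in> Hom C X Y" and v: "v \<in> Hom C Y Z" and w: "w \<in> Hom C Z (TO C X)"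
      using t unfolding dist_triangle_def triangle_def by auto
    note X = F.source.Hom_obj(1)[OF u]
    note \<phi>X = p.component[OF X, simplified] and \<psi>X = q.component[OF F.obj_closed[OF X], simplified]
    have "dist_triangle D (FObj F X) (FObj F Y) (FObj F Z) (FArr F u, FArr F v, \<phi> X \<cdot>\<^bsub>D\<^esub> FArr F w)"
      unfolding dist_triangle_def triangle_def
      using F[OF t] F.arr_closed[OF u] F.arr_closed[OF v]
        F.target.comp_closed[OF F.arr_closed[OF w] \<phi>X] by simp
    from G[OF this] show ?thesis
      using G.preserves_comp[OF F.arr_closed[OF w] \<phi>X]
        G.target.comp_assoc[OF G.arr_closed[OF F.arr_closed[OF w]] G.arr_closed[OF \<phi>X] \<psi>X]
      by (simp add: \<chi>_def)
  qed
  ultimately show ?thesis unfolding exact_functor_def by blast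
qed

lemma recollement_functors:
  assumes "recollement C' C C'' R"
  shows "is_functor C C' (i_upper_star R)" "is_functor C' C (i_lower_star R)"
    "is_functor C C' (i_upper_shriek R)" "is_functor C'' C (j_lower_shriek R)"
    "is_functor C C'' (j_upper_star R)" "is_functor C'' C (j_lower_star R)"
  using assms unfolding recollement_def by (blast intro: exact_functor_is_functor)+

lemma equivalent_recollements_refl:
  assumes "triangulated_category C" "recollement C' C C'' R"
  shows "equivalent_recollements C' C'' C R C R"
proof -
  have "category C"
    using assms(1) unfolding triangulated_category_def additive_category_def by blast
  then show ?thesis
    unfolding equivalent_recollements_def comparison_functor_def
    using exact_functor_id[OF assms(1)] equivalence_of_categories_id
      recollement_functors[OF assms(2), THEN nat_isomorphic_refl]
    by (intro exI[of _ id_functor]) simp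
qed

lemma nat_isomorphic_restrict_comp:
  assumes "nat_isomorphic C A P (Q \<circ>\<^sub>F f)" "nat_isomorphic D A Q (S \<circ>\<^sub>F g)" "is_functor C D f"
  shows "nat_isomorphic C A P (S \<circ>\<^sub>F (g \<circ>\<^sub>F f))"
  using nat_isomorphic_trans[OF assms(1) nat_isomorphic_whisker_right[OF assms(2,3)]]
  by (simp add: comp_functor_assoc)

lemma nat_isomorphic_extend_comp:
  assumes "nat_isomorphic A D (f \<circ>\<^sub>F P) Q" "nat_isomorphic A E (g \<circ>\<^sub>F Q) S" "is_functor D E g"
  shows "nat_isomorphic A E ((g \<circ>\<^sub>F f) \<circ>\<^sub>F P) S"
  using nat_isomorphic_trans[OF nat_isomorphic_whisker_left[OF assms(1,3)] assms(2)]
  by (simp add: comp_functor_assoc)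

lemma equivalent_recollements_trans:
  assumes "equivalent_recollements C' C'' C R D S" "equivalent_recollements C' C'' D S E T"
  shows "equivalent_recollements C' C'' C R E T"
proof -
  obtain f where f: "comparison_functor C' C'' C R D S f" "equivalence_of_categories C D f"
    using assms(1) unfolding equivalent_recollements_def by blast
  obtain g where g: "comparison_functor C' C'' D S E T g" "equivalence_of_categories D E g"
    using assms(2) unfolding equivalent_recollements_def by blast
  have fg: "is_functor C D f" "is_functor D E g"
    using f(2) g(2) unfolding equivalence_of_categories_def by blast+
  have "comparison_functor C' C'' C R E T (g \<circ>\<^sub>F f)"
    using f(1) g(1) unfolding comparison_functor_def
    by (auto intro: exact_functor_comp nat_isomorphic_restrict_comp[OF _ _ fg(1)]
        nat_isomorphic_extend_comp[OF _ _ fg(2)])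
  then show ?thesis
    unfolding equivalent_recollements_def
    using equivalence_of_categories_comp[OF f(2) g(2)] by blast
qed

section \<open>Extending a recollement by one step\<close>

text \<open>These four equations say that the last two rows of \<open>R\<close> are the first two rows of \<open>S\<close>. The last
  row of \<open>S\<close> plays the role of the functors with subscript \<open>?\<close>, and the first row of \<open>R\<close>
  that of the functors with superscript \<open>?\<close>, so both kinds of symmetry become the existence of
  a neighbour.\<close>

definition upper_neighbour ::
    "('a, 'b, 'o, 'm, 'c, 'd) recollement_data \<Rightarrow> ('c, 'd, 'o, 'm, 'a, 'b) recollement_data \<Rightarrow> bool" where
  "upper_neighbour R S \<longleftrightarrow>
    i_upper_star S = j_upper_star R \<and> i_lower_star S = j_lower_star R \<and>
    j_lower_shriek S = i_lower_star R \<and> j_upper_star S = i_upper_shriek R"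

lemma upper_symmetric_iff:
  "upper_symmetric C' C C'' R \<longleftrightarrow>
    recollement C' C C'' R \<and> (\<exists>S. recollement C'' C C' S \<and> upper_neighbour R S)"
proof -
  have "\<exists>j i. exact_functor C C'' j \<and> exact_functor C' C i \<and>
      recollement C'' C C'
        \<lparr>i_upper_star = j_upper_star R, i_lower_star = j_lower_star R, i_upper_shriek = j,
         j_lower_shriek = i_lower_star R, j_upper_star = i_upper_shriek R, j_lower_star = i\<rparr>"
    if "recollement C'' C C' S" "upper_neighbour R S" for S
  proof (intro exI conjI)
    show "exact_functor C C'' (i_upper_shriek S)" "exact_functor C' C (j_lower_star S)"
      using that(1) unfolding recollement_def by blast+
    show "recollement C'' C C'
        \<lparr>i_upper_star = j_upper_star R, i_lower_star = j_lower_star R,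
         i_upper_shriek = i_upper_shriek S, j_lower_shriek = i_lower_star R,
         j_upper_star = i_upper_shriek R, j_lower_star = j_lower_star S\<rparr>"
      using that by (cases S) (simp add: upper_neighbour_def)
  qed
  then show ?thesis
    unfolding upper_symmetric_def upper_neighbour_def by fastforce
qed

lemma lower_symmetric_iff:
  "lower_symmetric C'' C C' S \<longleftrightarrow>
    recollement C'' C C' S \<and> (\<exists>R. recollement C' C C'' R \<and> upper_neighbour R S)"
proof -
  have "\<exists>j i. exact_functor C C' j \<and> exact_functor C'' C i \<and>
      recollement C' C C''
        \<lparr>i_upper_star = j, i_lower_star = j_lower_shriek S, i_upper_shriek = j_upper_star S,
         j_lower_shriek = i, j_upper_star = i_upper_star S, j_lower_star = i_lower_star S\<rparr>"
    if "recollement C' C C'' R" "upper_neighbour R S" for R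
  proof (intro exI conjI)
    show "exact_functor C C' (i_upper_star R)" "exact_functor C'' C (j_lower_shriek R)"
      using that(1) unfolding recollement_def by blast+
    show "recollement C' C C''
        \<lparr>i_upper_star = i_upper_star R, i_lower_star = j_lower_shriek S,
         i_upper_shriek = j_upper_star S, j_lower_shriek = j_lower_shriek R,
         j_upper_star = i_upper_star S, j_lower_star = i_lower_star S\<rparr>"
      using that by (cases R) (simp add: upper_neighbour_def)
  qed
  then show ?thesis
    unfolding lower_symmetric_def upper_neighbour_def by fastforce
qed

text \<open>A comparison functor is compatible with the shared rows in either case. Going from \<open>R\<close> to \<open>S\<close>,
  the new row consists of the right adjoints of \<open>j\<^sub>*\<close> and \<open>i\<^sup>!\<close> of \<open>R\<close>; going back, it consists
  of the left adjoints of \<open>j\<^sub>!\<close> and \<open>i\<^sup>*\<close> of \<open>S\<close>.\<close>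

lemma equivalent_recollements_upper_neighbour_iff:
  assumes R: "recollement C' C C'' R" and R': "recollement C' D C'' R'"
    and S: "recollement C'' C C' S" and S': "recollement C'' D C' S'"
    and RS: "upper_neighbour R S" and RS': "upper_neighbour R' S'"
  shows "equivalent_recollements C' C'' C R D R' \<longleftrightarrow> equivalent_recollements C'' C' C S D S'"
proof -
  note eqs = RS[unfolded upper_neighbour_def] RS'[unfolded upper_neighbour_def]
  have "comparison_functor C'' C' C S D S' f"
    if f: "comparison_functor C' C'' C R D R' f" "equivalence_of_categories C D f" for f
  proof -
    obtain a b a' b' where "adjunction C'' C (i_lower_star S) (i_upper_shriek S) a b"
      "adjunction C'' D (i_lower_star S') (i_upper_shriek S') a' b'"
      using S S' unfolding recollement_def by blast
    then have "nat_isomorphic C C'' (i_upper_shriek S) (i_upper_shriek S' \<circ>\<^sub>F f)"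
      using f eqs right_adjoint_source_equivalence[OF adjunction_is_right_adjoint
          adjunction_is_right_adjoint]
      unfolding comparison_functor_def by metis
    moreover obtain a b a' b' where "adjunction C C' (j_upper_star S) (j_lower_star S) a b"
      "adjunction D C' (j_upper_star S') (j_lower_star S') a' b'"
      using S S' unfolding recollement_def by blast
    then have "nat_isomorphic C' D (f \<circ>\<^sub>F j_lower_star S) (j_lower_star S')"
      using f eqs right_adjoint_target_equivalence[OF adjunction_is_right_adjoint
          adjunction_is_right_adjoint]
      unfolding comparison_functor_def by metis
    ultimately show ?thesis
      using f(1) eqs unfolding comparison_functor_def by simp
  qed
  moreover have "comparison_functor C' C'' C R D R' f"
    if f: "comparison_functor C'' C' C S D S' f" "equivalence_of_categories C D f" for f
  proof -
    obtain a b a' b' where "adjunction C C' (i_upper_star R) (i_lower_star R) a b"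
      "adjunction D C' (i_upper_star R') (i_lower_star R') a' b'"
      using R R' unfolding recollement_def by blast
    then have "nat_isomorphic C C' (i_upper_star R) (i_upper_star R' \<circ>\<^sub>F f)"
      using f eqs left_adjoint_source_equivalence
      unfolding comparison_functor_def by metis
    moreover obtain a b a' b' where "adjunction C'' C (j_lower_shriek R) (j_upper_star R) a b"
      "adjunction C'' D (j_lower_shriek R') (j_upper_star R') a' b'"
      using R R' unfolding recollement_def by blast
    then have "nat_isomorphic C'' D (f \<circ>\<^sub>F j_lower_shriek R) (j_lower_shriek R')"
      using f eqs left_adjoint_target_equivalence
      unfolding comparison_functor_def by metis
    ultimately show ?thesis
      using f(1) eqs unfolding comparison_functor_def by simp
  qed
  ultimately show ?thesis
    unfolding equivalent_recollements_def by blast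
qed

section \<open>The bijection on equivalence classes\<close>

text \<open>For preorders, equality of two classes means being related in both directions, and \<open>transfer\<close> preserves each direction. A class is mapped by
  first moving it along \<open>N\<close> and then closing up under \<open>s\<close>, which involves no choice of
  representatives.\<close>

lemma quotient_bij_betw_if_correspondence:
  assumes "refl_on A r" "trans r" "refl_on B s" "trans s" "r \<subseteq> A \<times> A" "s \<subseteq> B \<times> B"
    and left_total: "\<And>x. x \<in> A \<Longrightarrow> \<exists>y\<in>B. (x, y) \<in> N"
    and right_total: "\<And>y. y \<in> B \<Longrightarrow> \<exists>x\<in>A. (x, y) \<in> N"
    and transfer: "\<And>x x' y y'. \<lbrakk>x \<in> A; x' \<in> A; y \<in> B; y' \<in> B; (x, y) \<in> N; (x', y') \<in> N\<rbrakk> \<Longrightarrow>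
      (x, x') \<in> r \<longleftrightarrow> (y, y') \<in> s"
  shows "bij_betw (\<lambda>K. s `` (N `` K)) (A // r) (B // s)"
proof -
  have image_class: "s `` (N `` (r `` {x})) = s `` {y}" if x: "x \<in> A" and y: "y \<in> B" "(x, y) \<in> N" for x y
  proof (intro equalityI subsetI)
    fix z assume "z \<in> s `` (N `` (r `` {x}))"
    then obtain x' y' where z: "(x, x') \<in> r" "(x', y') \<in> N" "(y', z) \<in> s" by blast
    then have "(y, y') \<in> s" using transfer x y assms(5,6) by blast
    then show "z \<in> s `` {y}" using z(3) transD[OF assms(4)] by blast
  next
    fix z assume "z \<in> s `` {y}"
    moreover have "(x, x) \<in> r" using x assms(1) by (simp add: refl_on_def)
    ultimately show "z \<in> s `` (N `` (r `` {x}))" using y by blast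
  qed
  have r_eq: "r `` {x} = r `` {x'} \<longleftrightarrow> (x, x') \<in> r \<and> (x', x) \<in> r" if "x \<in> A" "x' \<in> A" for x x'
    using that assms(1,2) unfolding refl_on_def trans_def by blast
  have s_eq: "s `` {y} = s `` {y'} \<longleftrightarrow> (y, y') \<in> s \<and> (y', y) \<in> s" if "y \<in> B" "y' \<in> B" for y y'
    using that assms(3,4) unfolding refl_on_def trans_def by blast
  show ?thesis
    unfolding bij_betw_def
  proof (intro conjI inj_onI)
    fix K K' assume "K \<in> A // r" "K' \<in> A // r" and eq: "s `` (N `` K) = s `` (N `` K')"
    then obtain x x' where x: "x \<in> A" "K = r `` {x}" "x' \<in> A" "K' = r `` {x'}"
      by (auto elim!: quotientE)
    obtain y y' where y: "y \<in> B" "(x, y) \<in> N" "y' \<in> B" "(x', y') \<in> N"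
      using left_total x by meson
    have "s `` {y} = s `` {y'}" using eq image_class x y by metis
    then show "K = K'" using r_eq s_eq transfer x y by metis
  next
    show "(\<lambda>K. s `` (N `` K)) ` (A // r) = B // s"
    proof (intro equalityI subsetI)
      fix M assume "M \<in> (\<lambda>K. s `` (N `` K)) ` (A // r)"
      then obtain x where x: "x \<in> A" "M = s `` (N `` (r `` {x}))" by (auto elim!: quotientE)
      moreover obtain y where "y \<in> B" "(x, y) \<in> N" using left_total x by meson
      ultimately show "M \<in> B // s" using image_class by (auto intro: quotientI)
    next
      fix M assume "M \<in> B // s"
      then obtain y where y: "y \<in> B" "M = s `` {y}" by (auto elim!: quotientE)
      moreover obtain x where "x \<in> A" "(x, y) \<in> N" using right_total y by meson
      ultimately show "M \<in> (\<lambda>K. s `` (N `` K)) ` (A // r)"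
        using image_class quotientI by (metis image_eqI)
    qed
  qed
qed

theorem theorem2p3:
  fixes C' :: "('a, 'b) tri_cat" and C :: "('o, 'm) tri_cat" and C'' :: "('c, 'd) tri_cat"
  assumes "triangulated_category C'"
    and "triangulated_category C"
    and "triangulated_category C''"
  shows "\<exists>\<Phi>. bij_betw \<Phi> (USR C' C C'') (LSR C'' C C')"
proof -
  let ?U = "{R. upper_symmetric C' C C'' R}" and ?L = "{S. lower_symmetric C'' C C' S}"
  let ?r = "{(R, R'). upper_symmetric C' C C'' R \<and> upper_symmetric C' C C'' R' \<and>
    equivalent_recollements C' C'' C R C R'}"
  let ?s = "{(S, S'). lower_symmetric C'' C C' S \<and> lower_symmetric C'' C C' S' \<and>
    equivalent_recollements C'' C' C S C S'}"
  let ?N = "{(R, S). upper_neighbour R S}"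
  have "bij_betw (\<lambda>K. ?s `` (?N `` K)) (?U // ?r) (?L // ?s)"
  proof (rule quotient_bij_betw_if_correspondence)
    show "refl_on ?U ?r"
      using equivalent_recollements_refl[OF assms(2)] by (auto simp: refl_on_def upper_symmetric_def)
    show "refl_on ?L ?s"
      using equivalent_recollements_refl[OF assms(2)] by (auto simp: refl_on_def lower_symmetric_def)
    show "trans ?r" "trans ?s"
      by (auto simp: trans_def intro: equivalent_recollements_trans)
    show "\<exists>S\<in>?L. (R, S) \<in> ?N" if "R \<in> ?U" for R
      using that by (auto simp: upper_symmetric_iff lower_symmetric_iff)
    show "\<exists>R\<in>?U. (R, S) \<in> ?N" if "S \<in> ?L" for S
      using that by (auto simp: upper_symmetric_iff lower_symmetric_iff)
    show "(R, R') \<in> ?r \<longleftrightarrow> (S, S') \<in> ?s"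
      if "R \<in> ?U" "R' \<in> ?U" "S \<in> ?L" "S' \<in> ?L" "(R, S) \<in> ?N" "(R', S') \<in> ?N" for R R' S S'
      using that equivalent_recollements_upper_neighbour_iff[of C' C C'' R C R' S S']
      by (auto simp: upper_symmetric_def lower_symmetric_def)
  qed auto
  then show ?thesis unfolding USR_def LSR_def by blast
qed

end
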